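(* Let $S\subseteq\mathbb{R}^n$ be a basic closed semi-algebraic set that contains tentacles $T_{K_j,z^{(j)}}$, where $K_j\subseteq\mathbb{R}^n$ is compact with nonempty interior and $z^{(j)}\in\mathbb{Z}^n$ ($j=1,\ldots,m$). (1) If there exist $r_1,\ldots,r_m\in\mathbb{N}$ such that $r_1z^{(1)}+\cdots+r_mz^{(m)}\succ0$, then every finitely generated quadratic module $M\subseteq\mathbb{R}[X_1,\ldots,X_n]$ with $\mathcal{S}(M)=S$ is stable and closed. Consequently, if $n\ge2$, no such quadratic module has the Strong Moment Property. (2) Such natural numbers $r_1,\ldots,r_m$ exist if and only if the only polynomial functions which are bounded on $\bigcup_{j=1}^mT_{K_j,z^{(j)}}$ are the real constants.
   Context: Let $A=\mathbb{R}[X_1,\ldots,X_n]$, and $\mathbb{N}=\{0,1,2,\ldots\}$. For $v\in\mathbb{Z}^n$, $v\succ0$ means that every component of $v$ is strictly positive. For $z\in\mathbb{Z}^n$ and $K\subseteq\mathbb{R}^n$ compact with nonempty interior, the tentacle of $K$ in direction $z$ is $$T_{K,z}=\{(\lambda^{z_1}x_1,\ldots,\lambda^{z_n}x_n)\mid\lambda\ge1,\ (x_1,\ldots,x_n)\in K\}.$$ A quadratic module in $A$ is a subset $M\subseteq A$ with $1\in M$, $M+M\subseteq M$ and $a^2M\subseteq M$ for all $a\in A$. $\mathrm{QM}(f_1,\ldots,f_s)=\{\sigma_0+\sigma_1f_1+\cdots+\sigma_sf_s\mid\sigma_i\in\sum A^2\}$ is the quadratic module generated by $f_1,\ldots,f_s$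 ($\sum A^2$ is the set of sums of squares). $\mathcal{S}(M)=\{x\in\mathbb{R}^n\mid f(x)\ge0\text{ for all }f\in M\}$; a set is basic closed semi-algebraic if it is of the form $\{x\in\mathbb{R}^n\mid f_1(x)\ge0,\ldots,f_s(x)\ge0\}$ for finitely many $f_i\in A$. For a linear subspace $W\subseteq A$, $\sum(W;f_1,\ldots,f_s)$ is the set of all $\sigma_0+\sigma_1f_1+\cdots+\sigma_sf_s$ where each $\sigma_i$ is a sum of squares of elements of $W$. $M=\mathrm{QM}(f_1,\ldots,f_s)$ is stable if for every finite dimensional subspace $U$ of $A$ there is a finite dimensional subspace $W$ of $A$ with $M\cap U\subseteq\sum(W;f_1,\ldots,f_s)$ (this does not depend on the choice of the finite generating set). $M$ is closed if it is closed in the finest locally convex topology on $A$, equivalently $M=M^{\vee\vee}$, where $M^{\vee\vee}$ is the set of $f\in A$ with $L(f)\ge0$ for every linear functional $L:A\to\mathbb{R}$ that is nonnegative on $M$. $M$ has the Strong Moment Property if every linear functional on $A$ which is nonnegative on $M$ is integration with respect to a (positive Borel) measure on $\mathcal{S}(M)$. *)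

theory Defs
  imports "HOL-Analysis.Analysis" "HOL-Library.Poly_Mapping"
begin

text \<open>
  A polynomial in \<open>n = CARD('n)\<close> real variables is the finitely supported map that sends a
  multi-index in \<open>\<nat>\<^sup>n\<close> to its coefficient; the ring structure (convolution product) is that of
  \<^theory>\<open>HOL-Library.Poly_Mapping\<close>.
\<close>

type_synonym 'n rpoly = "(nat ^ 'n) \<Rightarrow>\<^sub>0 real"

instantiation poly_mapping :: (type, real_vector) real_vector
begin

definition scaleR_poly_mapping :: "real \<Rightarrow> ('a \<Rightarrow>\<^sub>0 'b) \<Rightarrow> ('a \<Rightarrow>\<^sub>0 'b)"
  where "scaleR_poly_mapping c p = Poly_Mapping.map (\<lambda>b. c *\<^sub>R b) p"

lemma lookup_scaleR [simp]: "Poly_Mapping.lookup (c *\<^sub>R p) k = c *\<^sub>R Poly_Mapping.lookup p k"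
  by (simp add: scaleR_poly_mapping_def Poly_Mapping.map.rep_eq when_def)

instance
  by standard
    (rule poly_mapping_eqI, simp add: lookup_add scaleR_add_right scaleR_add_left)+

end

definition peval :: "('n::finite) rpoly \<Rightarrow> real ^ 'n \<Rightarrow> real"
  where "peval p x = (\<Sum>\<alpha>\<in>Poly_Mapping.keys p. Poly_Mapping.lookup p \<alpha> * (\<Prod>i\<in>UNIV. (x $ i) ^ (\<alpha> $ i)))"


subsection \<open>Tentacles\<close>

definition strictly_positive :: "int ^ ('n::finite) \<Rightarrow> bool"
  where "strictly_positive v \<longleftrightarrow> (\<forall>i. 0 < v $ i)"

definition tentacle :: "(real ^ ('n::finite)) set \<Rightarrow> int ^ 'n \<Rightarrow> (real ^ 'n) set"
  where "tentacle K z = {(\<chi> i. (l powi (z $ i)) * x $ i) | l x. 1 \<le> l \<and> x \<in> K}"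


subsection \<open>Quadratic modules\<close>

definition quadratic_module :: "('n::finite) rpoly set \<Rightarrow> bool"
  where "quadratic_module M \<longleftrightarrow>
    1 \<in> M \<and> (\<forall>f\<in>M. \<forall>g\<in>M. f + g \<in> M) \<and> (\<forall>a. \<forall>f\<in>M. a\<^sup>2 * f \<in> M)"

definition sums_of_squares :: "('n::finite) rpoly set \<Rightarrow> 'n rpoly set"
  where "sums_of_squares W = {(\<Sum>a\<leftarrow>as. a\<^sup>2) | as. set as \<subseteq> W}"

definition restricted_QM :: "('n::finite) rpoly set \<Rightarrow> 'n rpoly list \<Rightarrow> 'n rpoly set"
  where "restricted_QM W fs =
    {\<sigma>\<^sub>0 + (\<Sum>i<length fs. \<sigma> i * fs ! i) | \<sigma>\<^sub>0 \<sigma>.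
       \<sigma>\<^sub>0 \<in> sums_of_squares W \<and> (\<forall>i<length fs. \<sigma> i \<in> sums_of_squares W)}"

definition QM :: "('n::finite) rpoly list \<Rightarrow> 'n rpoly set"
  where "QM fs = restricted_QM UNIV fs"

definition fin_gen_quadratic_module :: "('n::finite) rpoly set \<Rightarrow> bool"
  where "fin_gen_quadratic_module M \<longleftrightarrow> quadratic_module M \<and> (\<exists>fs. M = QM fs)"

definition nonneg_set :: "('n::finite) rpoly set \<Rightarrow> (real ^ 'n) set"
  where "nonneg_set M = {x. \<forall>f\<in>M. 0 \<le> peval f x}"

definition basic_closed_semialgebraic :: "(real ^ ('n::finite)) set \<Rightarrow> bool"
  where "basic_closed_semialgebraic S \<longleftrightarrow> (\<exists>F. finite F \<and> S = {x. \<forall>f\<in>F. 0 \<le> peval f x})"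


subsection \<open>Stability, closedness and the Strong Moment Property\<close>

definition fin_dim_subspace :: "('a::real_vector) set \<Rightarrow> bool"
  where "fin_dim_subspace U \<longleftrightarrow> (\<exists>B. finite B \<and> U = span B)"

text \<open>
  The condition does not depend on the chosen generators, so for a finitely generated \<open>M\<close> it is
  immaterial whether it is required of one generating list or of all of them.
\<close>

definition stable_QM :: "('n::finite) rpoly set \<Rightarrow> bool"
  where "stable_QM M \<longleftrightarrow>
    (\<exists>fs. M = QM fs \<and>
      (\<forall>U. fin_dim_subspace U \<longrightarrow>
        (\<exists>W. fin_dim_subspace W \<and> M \<inter> U \<subseteq> restricted_QM W fs)))"

definition seminorm :: "('a::real_vector \<Rightarrow> real) \<Rightarrow> bool"
  where "seminorm q \<longleftrightarrow>
    (\<forall>x y. q (x + y) \<le> q x + q y) \<and> (\<forall>c x. q (c *\<^sub>R x) = \<bar>c\<bar> * q x)"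

text \<open>
  The finest locally convex topology on a real vector space is the one defined by the family of
  all its seminorms.
\<close>

definition finest_lc_topology :: "('a::real_vector) topology"
  where "finest_lc_topology =
    topology_generated_by {{y. q (y - x) < e} | q x e. seminorm q \<and> 0 < e}"

definition closed_QM :: "('n::finite) rpoly set \<Rightarrow> bool"
  where "closed_QM M \<longleftrightarrow> closedin finest_lc_topology M"

text \<open>
  A positive Borel measure on \<open>\<S>(M)\<close> is a measure on the Borel sigma-algebra of that subspace.
  Integrability of every polynomial is part of representing \<open>L\<close>, since the Bochner integral of
  a non-integrable function is 0 by convention.
\<close>

definition strong_moment_property :: "('n::finite) rpoly set \<Rightarrow> bool"
  where "strong_moment_property M \<longleftrightarrow>
    (\<forall>L. linear L \<and> (\<forall>f\<in>M. 0 \<le> L f) \<longrightarrow>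
      (\<exists>\<mu>. sets \<mu> = sets (restrict_space borel (nonneg_set M)) \<and>
        (\<forall>f. integrable \<mu> (peval f) \<and> L f = integral\<^sup>L \<mu> (peval f))))"

end

theory Submission
  imports Defs
begin

text \<open>
  Give the monomial \<open>x\<^sup>\<alpha>\<close> the degree \<open>z \<bullet> \<alpha>\<close>. Along a tentacle in direction \<open>z\<close> a polynomial grows
  like \<open>\<lambda>\<close> to the power of its degree, and its leading form governs the growth
  (\<open>tendsto_leading_form\<close>). In a representation \<open>f = \<Sum> a\<^sup>2 h\<close>, with \<open>h\<close> running over \<open>1\<close> and the
  generators, all terms are nonnegative on the tentacle, so each one is dominated by \<open>f\<close> there.
  Leading terms therefore cannot cancel, and the degree of every \<open>a\<close> is bounded by that of \<open>f\<close>
  (\<open>wdeg_bound_of_dominated\<close>). If a nonnegative integer combination of the directions is strictly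
  positive, the bounds for the directions \<open>z\<^sup>(\<^sup>j\<^sup>)\<close> together leave only finitely many exponents
  (\<open>finite_exponents_wdeg_le\<close>). This is stability (\<open>certificates_of_bounded_degree\<close>).

  Closedness rests on compactness. Sums of squares with prescribed support need only boundedly
  many squares (\<open>sum_of_squares_shorten\<close>), and a bound on a ball where the nonzero generators are
  bounded below by a positive constant bounds the coefficients of all the squares
  (\<open>coefficient_bound\<close>); so a coefficientwise limit of elements of \<open>M\<close> of bounded support lies in
  \<open>M\<close> (\<open>QM_coefficientwise_limit\<close>). A polynomial \<open>f\<close> outside \<open>M\<close> then has a neighbourhood outside
  \<open>M\<close>: a box around \<open>f\<close> whose side lengths are chosen one degree after the other
  (\<open>seminorm_separation\<close>).

  By the Hahn-Banach theorem some functional that is nonnegative on \<open>M\<close> is negative at \<open>f\<close>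
  (\<open>separating_functional\<close>), so under the Strong Moment Property \<open>M\<close> would contain every
  polynomial that is nonnegative everywhere. This is impossible for \<open>n \<ge> 2\<close>. Shrink the
  polynomial \<open>x\<^sup>4y\<^sup>2 + x\<^sup>2y\<^sup>4 - x\<^sup>2y\<^sup>2 + 1\<close> to smaller and smaller scales around a point where all
  nonzero generators are positive. By stability its certificates have bounded degree, and on
  rescaling, the generators tend to positive constants; in the limit the polynomial would be a
  sum of squares with positive weights, which it is not (\<open>berg_not_weighted_squares\<close>).

  For the second part, the same degree bound shows that a polynomial that is bounded on all
  tentacles has no exponent except \<open>0\<close> when the combination exists. When it does not, an integer
  theorem of alternatives yields \<open>\<alpha> \<noteq> 0\<close> with \<open>z\<^sup>(\<^sup>j\<^sup>) \<bullet> \<alpha> \<le> 0\<close> for all \<open>j\<close>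
  (\<open>strictly_positive_combination_or_exponent\<close>), and \<open>x\<^sup>\<alpha>\<close> is a nonconstant bounded polynomial.
\<close>

section \<open>Polynomials and their evaluation\<close>

abbreviation keys where "keys \<equiv> Poly_Mapping.keys"
abbreviation lookup where "lookup \<equiv> Poly_Mapping.lookup"
abbreviation single where "single \<equiv> Poly_Mapping.single"

definition mon :: "nat ^ 'n::finite \<Rightarrow> real ^ 'n \<Rightarrow> real"
  where "mon \<alpha> x = (\<Prod>i\<in>UNIV. (x $ i) ^ (\<alpha> $ i))"

definition supported :: "(nat ^ 'n::finite) set \<Rightarrow> 'n rpoly set"
  where "supported A = {p. keys p \<subseteq> A}"

lemma mon_0 [simp]: "mon 0 x = 1"
  by (simp add: mon_def)

lemma mon_add: "mon (\<alpha> + \<beta>) x = mon \<alpha> x * mon \<beta> x"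
  by (simp add: mon_def power_add prod.distrib)

lemma continuous_on_mon [continuous_intros]: "continuous_on U (mon \<alpha>)"
  unfolding mon_def by (intro continuous_intros)

lemma peval_alt:
  assumes "finite A" "keys p \<subseteq> A"
  shows "peval p x = (\<Sum>\<alpha>\<in>A. lookup p \<alpha> * mon \<alpha> x)"
  unfolding peval_def mon_def using assms
  by (intro sum.mono_neutral_left) (auto simp: in_keys_iff)

lemma peval_keys: "peval p x = (\<Sum>\<alpha>\<in>keys p. lookup p \<alpha> * mon \<alpha> x)"
  by (rule peval_alt) auto

lemma peval_zero [simp]: "peval 0 x = 0"
  by (simp add: peval_def)

lemma peval_single [simp]: "peval (single \<alpha> c) x = c * mon \<alpha> x"
  by (subst peval_alt[of "{\<alpha>}"]) auto

lemma peval_one [simp]: "peval 1 x = 1"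
  using peval_single[of 0 1] by simp

lemma peval_add: "peval (p + q) x = peval p x + peval q x"
proof -
  have "keys (p + q) \<subseteq> keys p \<union> keys q" by (rule keys_add)
  then show ?thesis
    by (simp add: peval_alt[of "keys p \<union> keys q"] lookup_add distrib_right sum.distrib)
qed

lemma peval_sum: "peval (\<Sum>i\<in>I. p i) x = (\<Sum>i\<in>I. peval (p i) x)"
  by (induction I rule: infinite_finite_induct) (auto simp: peval_add)

lemma peval_uminus [simp]: "peval (- p) x = - peval p x"
  by (simp add: peval_keys sum_negf)

lemma peval_diff: "peval (p - q) x = peval p x - peval q x"
  using peval_add[of p "- q" x] by simp

lemma poly_expand: "p = (\<Sum>\<alpha>\<in>keys p. single \<alpha> (lookup p \<alpha>))"
  by (rule poly_mapping_eqI)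
    (auto simp: lookup_sum lookup_single when_def in_keys_iff sum.delta)

lemma peval_mult: "peval (p * q) x = peval p x * peval q x"
proof -
  have "p * q = (\<Sum>\<alpha>\<in>keys p. \<Sum>\<beta>\<in>keys q. single (\<alpha> + \<beta>) (lookup p \<alpha> * lookup q \<beta>))"
    by (subst (1) poly_expand[of p], subst (1) poly_expand[of q])
      (simp add: sum_product mult_single)
  then have "peval (p * q) x = (\<Sum>\<alpha>\<in>keys p. \<Sum>\<beta>\<in>keys q. lookup p \<alpha> * lookup q \<beta> * mon (\<alpha> + \<beta>) x)"
    by (simp only: peval_sum peval_single)
  also have "\<dots> = peval p x * peval q x"
    unfolding peval_keys sum_product by (intro sum.cong refl) (simp add: mon_add ac_simps)
  finally show ?thesis .
qed

lemma peval_power2 [simp]: "peval (p\<^sup>2) x = (peval p x)\<^sup>2"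
  by (simp add: power2_eq_square peval_mult)

lemma continuous_on_peval [continuous_intros]: "continuous_on U (peval p)"
  unfolding peval_keys[abs_def] by (intro continuous_intros)

lemma supported_peval:
  assumes "finite A"
  obtains p where "p \<in> supported A" "\<And>\<alpha>. \<alpha> \<in> A \<Longrightarrow> lookup p \<alpha> = c \<alpha>"
    "\<And>x. peval p x = (\<Sum>\<alpha>\<in>A. c \<alpha> * mon \<alpha> x)"
proof
  let ?p = "\<Sum>\<alpha>\<in>A. single \<alpha> (c \<alpha>)"
  show "?p \<in> supported A"
    using keys_sum[of "\<lambda>\<alpha>. single \<alpha> (c \<alpha>)" A] by (force simp: supported_def split: if_splits)
  show "lookup ?p \<alpha> = c \<alpha>" if "\<alpha> \<in> A" for \<alpha>
    using that assms by (simp add: lookup_sum lookup_single when_def)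
  show "peval ?p x = (\<Sum>\<alpha>\<in>A. c \<alpha> * mon \<alpha> x)" for x
    by (simp add: peval_sum)
qed

lemma supported_zero [simp]: "0 \<in> supported A"
  by (simp add: supported_def)

lemma supported_add: "p \<in> supported A \<Longrightarrow> q \<in> supported A \<Longrightarrow> p + q \<in> supported A"
  using keys_add[of p q] by (auto simp: supported_def)

lemma supported_diff: "p \<in> supported A \<Longrightarrow> q \<in> supported A \<Longrightarrow> p - q \<in> supported A"
  using keys_diff[of p q] by (auto simp: supported_def)

lemma supported_sum: "(\<And>i. i \<in> I \<Longrightarrow> p i \<in> supported A) \<Longrightarrow> (\<Sum>i\<in>I. p i) \<in> supported A"
  by (induction I rule: infinite_finite_induct) (auto simp: supported_add)

lemma supported_const_mult: "p \<in> supported A \<Longrightarrow> single 0 c * p \<in> supported A"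
  using keys_mult[of "single 0 c" p] by (force simp: supported_def split: if_splits)

lemma lookup_const_mult: "lookup (single 0 c * p) \<alpha> = c * lookup p \<alpha>"
proof -
  have "single 0 c * p = (\<Sum>\<beta>\<in>keys p. single \<beta> (c * lookup p \<beta>))"
    by (subst (1) poly_expand[of p]) (simp add: sum_distrib_left mult_single)
  then show ?thesis
    by (auto simp: lookup_sum lookup_single when_def in_keys_iff)
qed

lemma subspace_supported: "subspace (supported A :: ('n::finite) rpoly set)"
proof -
  have "keys (c *\<^sub>R p) \<subseteq> keys p" for c and p :: "'n rpoly"
    by (auto simp: in_keys_iff)
  then have "c *\<^sub>R p \<in> supported A" if "p \<in> supported A" for c and p :: "'n rpoly"
    using that unfolding supported_def by blast
  then show ?thesis
    unfolding subspace_def by (simp add: supported_add)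
qed

lemma fin_dim_subspace_supported:
  assumes "finite A"
  shows "fin_dim_subspace (supported A)"
proof -
  let ?B = "(\<lambda>\<alpha>. single \<alpha> (1::real)) ` A"
  have "p \<in> span ?B" if "p \<in> supported A" for p
  proof -
    have "p = (\<Sum>\<alpha>\<in>keys p. lookup p \<alpha> *\<^sub>R single \<alpha> 1)"
      by (rule poly_mapping_eqI)
        (auto simp: lookup_sum lookup_single when_def in_keys_iff sum.delta if_distrib cong: if_cong)
    also have "\<dots> \<in> span ?B"
      using that by (intro span_sum span_scale span_base) (auto simp: supported_def)
    finally show ?thesis .
  qed
  moreover have "?B \<subseteq> supported A"
    by (auto simp: supported_def)
  ultimately have "supported A = span ?B"
    using span_minimal[OF _ subspace_supported] by blast
  then show ?thesis
    using assms unfolding fin_dim_subspace_def by blast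
qed

text \<open>
  Finitely many spanning polynomials involve only finitely many monomials; so it suffices to
  study stability for the spaces \<open>supported A\<close>.
\<close>
lemma fin_dim_subspace_supportedE:
  fixes U :: "('n::finite) rpoly set"
  assumes "fin_dim_subspace U"
  obtains A where "finite A" "U \<subseteq> supported A"
proof -
  obtain B where B: "finite B" "U = span B"
    using assms unfolding fin_dim_subspace_def by blast
  let ?A = "\<Union>b\<in>B. keys b"
  have "B \<subseteq> supported ?A" by (auto simp: supported_def)
  then have "U \<subseteq> supported ?A"
    using B span_minimal[OF _ subspace_supported] by blast
  with B that[of ?A] show thesis by auto
qed

section \<open>Weighted degrees and the scaling along a tentacle\<close>

definition stretch :: "real \<Rightarrow> int ^ 'n::finite \<Rightarrow> real ^ 'n \<Rightarrow> real ^ 'n"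
  where "stretch l z x = (\<chi> i. (l powi (z $ i)) * x $ i)"

definition wdeg :: "int ^ 'n::finite \<Rightarrow> nat ^ 'n \<Rightarrow> int"
  where "wdeg z \<alpha> = (\<Sum>i\<in>UNIV. z $ i * int (\<alpha> $ i))"

lemma tentacle_stretch: "tentacle K z = {stretch l z x | l x. 1 \<le> l \<and> x \<in> K}"
  by (simp add: tentacle_def stretch_def)

lemma subset_tentacle: "K \<subseteq> tentacle K z"
proof
  fix x assume "x \<in> K"
  moreover have "stretch 1 z x = x" by (simp add: stretch_def)
  ultimately show "x \<in> tentacle K z" unfolding tentacle_stretch by (metis (mono_tags, lifting) mem_Collect_eq order_refl)
qed

lemma wdeg_0 [simp]: "wdeg z 0 = 0"
  by (simp add: wdeg_def)

lemma wdeg_add: "wdeg z (\<alpha> + \<beta>) = wdeg z \<alpha> + wdeg z \<beta>"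
  by (simp add: wdeg_def distrib_left sum.distrib)

lemma mon_stretch:
  assumes "l > 0"
  shows "mon \<alpha> (stretch l z x) = l powi (wdeg z \<alpha>) * mon \<alpha> x"
proof -
  have *: "l powi (\<Sum>i\<in>I. f i) = (\<Prod>i\<in>I. l powi (f i))" for f :: "'a \<Rightarrow> int" and I
    using assms by (induction I rule: infinite_finite_induct) (auto simp: power_int_add)
  show ?thesis
    unfolding mon_def stretch_def wdeg_def *
    by (simp add: power_mult_distrib prod.distrib power_int_mult)
qed

section \<open>Polynomials on open sets\<close>

lemma wdeg_axis: "wdeg (axis i k) \<alpha> = k * int (\<alpha> $ i)"
proof -
  have "axis i k $ j * int (\<alpha> $ j) = (if j = i then k * int (\<alpha> $ i) else 0)" for j
    by (simp add: axis_def)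
  then show ?thesis by (simp add: wdeg_def)
qed

lemma stretch_nonempty_open:
  fixes U :: "(real ^ 'n::finite) set"
  assumes "open U" "U \<noteq> {}"
  obtains l V where "l > 1" "open V" "V \<noteq> {}" "V \<subseteq> U" "\<And>x. x \<in> V \<Longrightarrow> stretch l z x \<in> U"
proof -
  obtain x0 where x0: "x0 \<in> U" using assms by auto
  have "((\<lambda>l. stretch l z x0) \<longlongrightarrow> stretch 1 z x0) (at 1)"
    unfolding stretch_def by (intro tendsto_intros tendsto_vec_lambda) auto
  moreover have "stretch 1 z x0 = x0" by (simp add: stretch_def)
  ultimately have "\<forall>\<^sub>F l in at 1. stretch l z x0 \<in> U"
    using assms x0 by (auto intro: topological_tendstoD)
  then obtain d where d: "d > 0" "\<And>l. l \<noteq> 1 \<Longrightarrow> dist l 1 < d \<Longrightarrow> stretch l z x0 \<in> U"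
    unfolding eventually_at by auto
  define l where "l = 1 + d / 2"
  have l: "l > 1" "stretch l z x0 \<in> U"
    using d by (auto simp: l_def dist_real_def)
  have "continuous_on UNIV (stretch l z)"
    unfolding stretch_def by (intro continuous_intros)
  then have "open (stretch l z -` U)"
    using assms open_vimage by blast
  then show thesis
    using that[of l "U \<inter> stretch l z -` U"] l x0 assms by auto
qed

text \<open>
  Moving a point of the open set along the diagonal makes all its coordinates nonzero, since only
  finitely many positions are excluded.
\<close>
lemma exists_mon_nonzero:
  fixes U :: "(real ^ 'n::finite) set"
  assumes "open U" "U \<noteq> {}"
  shows "\<exists>x\<in>U. mon \<alpha> x \<noteq> 0"
proof -
  obtain x where x: "x \<in> U" using assms by auto
  have "((\<lambda>t. x + (\<chi> i. t)) \<longlongrightarrow> x + (\<chi> i. 0)) (at_right (0::real))"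
    by (intro tendsto_intros tendsto_vec_lambda)
  moreover have "x + (\<chi> i. 0) = x" by (simp add: vec_eq_iff)
  ultimately have "\<forall>\<^sub>F t in at_right (0::real). x + (\<chi> i. t) \<in> U"
    using assms x by (auto intro: topological_tendstoD)
  then obtain d :: real where d: "d > 0" "\<And>t. 0 < t \<Longrightarrow> t < d \<Longrightarrow> x + (\<chi> i. t) \<in> U"
    unfolding eventually_at_right_field by auto
  have "infinite ({0<..<d} - (\<lambda>i. - (x $ i)) ` UNIV)"
    using d by (intro Diff_infinite_finite) auto
  then obtain t where t: "t \<in> {0<..<d} - (\<lambda>i. - (x $ i)) ` UNIV"
    using infinite_imp_nonempty by blast
  have "x $ i + t \<noteq> 0" for i
  proof
    assume "x $ i + t = 0"
    then have "t = - (x $ i)" by simp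
    with t show False by blast
  qed
  then have "mon \<alpha> (x + (\<chi> i. t)) \<noteq> 0"
    by (simp add: mon_def)
  with d t show ?thesis by auto
qed

text \<open>
  The equivalence of two norms on a finite dimensional space of polynomials: the supremum over an
  open set and the maximum of the coefficients. The induction removes one monomial \<open>a\<close> at a time:
  scaling one coordinate by \<open>l > 1\<close> multiplies each monomial by a power of \<open>l\<close>, so
  \<open>p(l x) - l\<^sup>a p(x)\<close> loses the monomial \<open>a\<close> but keeps any monomial whose exponent differs from \<open>a\<close>
  in that coordinate. The factor \<open>B\<close> is kept explicit so that \<open>B = 0\<close> gives the identity theorem.
\<close>
lemma coefficient_bound:
  fixes U :: "(real ^ 'n::finite) set"
  assumes "finite A" "open U" "U \<noteq> {}"
  shows "\<exists>R\<ge>0. \<forall>c B. (\<forall>x\<in>U. \<bar>\<Sum>\<alpha>\<in>A. c \<alpha> * mon \<alpha> x\<bar> \<le> B) \<longrightarrow> (\<forall>\<alpha>\<in>A. \<bar>c \<alpha>\<bar> \<le> R * B)"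
  using assms
proof (induction A arbitrary: U rule: finite_induct)
  case empty
  then show ?case by auto
next
  case (insert a A)
  have B0: "0 \<le> B" if "\<forall>x\<in>U. \<bar>\<Sum>\<alpha>\<in>insert a A. c \<alpha> * mon \<alpha> x\<bar> \<le> B" for c B
    using that insert.prems by (metis abs_ge_zero all_not_in_conv order_trans)
  have "\<exists>R\<ge>0. \<forall>c B. (\<forall>x\<in>U. \<bar>\<Sum>\<alpha>\<in>insert a A. c \<alpha> * mon \<alpha> x\<bar> \<le> B) \<longrightarrow> \<bar>c b\<bar> \<le> R * B"
    if b: "b \<in> A" for b
  proof -
    from b insert.hyps have "a \<noteq> b" by auto
    then obtain i where i: "a $ i \<noteq> b $ i" by (auto simp: vec_eq_iff)
    define z :: "int ^ 'n" where "z = axis i 1"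
    have z: "wdeg z \<alpha> = int (\<alpha> $ i)" for \<alpha>
      by (simp add: z_def wdeg_axis)
    obtain l V where l: "l > 1" and V: "open V" "V \<noteq> {}" "V \<subseteq> U" "\<And>x. x \<in> V \<Longrightarrow> stretch l z x \<in> U"
      using stretch_nonempty_open[OF insert.prems, of z] by blast
    from insert.IH[OF V(1,2)] obtain R where R: "R \<ge> 0"
      "\<And>c B \<alpha>. (\<forall>x\<in>V. \<bar>\<Sum>\<alpha>\<in>A. c \<alpha> * mon \<alpha> x\<bar> \<le> B) \<Longrightarrow> \<alpha> \<in> A \<Longrightarrow> \<bar>c \<alpha>\<bar> \<le> R * B"
      by blast
    define w where "w \<alpha> = l ^ (\<alpha> $ i)" for \<alpha> :: "nat ^ 'n"
    have w: "w a > 0" "w b \<noteq> w a"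
      using l i by (auto simp: w_def)
    have "\<bar>c b\<bar> \<le> R * (1 + w a) / \<bar>w b - w a\<bar> * B"
      if c: "\<forall>x\<in>U. \<bar>\<Sum>\<alpha>\<in>insert a A. c \<alpha> * mon \<alpha> x\<bar> \<le> B" for c B
    proof -
      have "\<bar>\<Sum>\<alpha>\<in>A. (c \<alpha> * (w \<alpha> - w a)) * mon \<alpha> x\<bar> \<le> B * (1 + w a)" if x: "x \<in> V" for x
      proof -
        let ?p = "\<lambda>x. \<Sum>\<alpha>\<in>insert a A. c \<alpha> * mon \<alpha> x"
        have "(\<Sum>\<alpha>\<in>A. (c \<alpha> * (w \<alpha> - w a)) * mon \<alpha> x)
            = (\<Sum>\<alpha>\<in>insert a A. (c \<alpha> * (w \<alpha> - w a)) * mon \<alpha> x)"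
          using insert.hyps by simp
        also have "\<dots> = ?p (stretch l z x) - w a * ?p x"
          unfolding sum_distrib_left sum_subtractf[symmetric] using l
          by (intro sum.cong) (auto simp: mon_stretch z w_def algebra_simps)
        also have "\<bar>\<dots>\<bar> \<le> \<bar>?p (stretch l z x)\<bar> + w a * \<bar>?p x\<bar>"
          using w(1) by (simp add: abs_mult order.trans[OF abs_triangle_ineq4])
        also have "\<dots> \<le> B + w a * B"
          using c V x w(1) by (intro add_mono mult_left_mono) auto
        finally show ?thesis by (simp add: algebra_simps)
      qed
      then have "\<bar>c b * (w b - w a)\<bar> \<le> R * (B * (1 + w a))"
        using R(2)[of "\<lambda>\<alpha>. c \<alpha> * (w \<alpha> - w a)"] b by blast
      then have "\<bar>c b\<bar> * \<bar>w b - w a\<bar> \<le> R * (1 + w a) * B"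
        by (simp only: abs_mult ac_simps)
      then show ?thesis
        using w(2) by (simp add: pos_le_divide_eq)
    qed
    moreover have "R * (1 + w a) / \<bar>w b - w a\<bar> \<ge> 0"
      using R(1) w(1) by auto
    ultimately show ?thesis by blast
  qed
  then have "\<forall>b\<in>A. \<exists>R. R \<ge> 0 \<and>
      (\<forall>c B. (\<forall>x\<in>U. \<bar>\<Sum>\<alpha>\<in>insert a A. c \<alpha> * mon \<alpha> x\<bar> \<le> B) \<longrightarrow> \<bar>c b\<bar> \<le> R * B)"
    by blast
  from bchoice[OF this] obtain r where r: "\<And>b. b \<in> A \<Longrightarrow> r b \<ge> 0"
    "\<And>b c B. b \<in> A \<Longrightarrow> (\<forall>x\<in>U. \<bar>\<Sum>\<alpha>\<in>insert a A. c \<alpha> * mon \<alpha> x\<bar> \<le> B) \<Longrightarrow> \<bar>c b\<bar> \<le> r b * B"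
    by blast
  obtain x where x: "x \<in> U" "mon a x \<noteq> 0"
    using exists_mon_nonzero[OF insert.prems] by blast
  define ra where "ra = (1 + (\<Sum>b\<in>A. r b * \<bar>mon b x\<bar>)) / \<bar>mon a x\<bar>"
  have ra: "ra \<ge> 0"
    unfolding ra_def using r(1) by (intro divide_nonneg_nonneg add_nonneg_nonneg sum_nonneg) auto
  define R where "R = ra + (\<Sum>b\<in>A. r b)"
  have R: "R \<ge> 0" "ra \<le> R" "\<And>b. b \<in> A \<Longrightarrow> r b \<le> R"
    unfolding R_def using ra r(1) insert.hyps member_le_sum[of _ A r]
    by (auto intro!: add_nonneg_nonneg sum_nonneg add_increasing)
  have "\<bar>c \<alpha>\<bar> \<le> R * B"
    if c: "\<forall>x\<in>U. \<bar>\<Sum>\<alpha>\<in>insert a A. c \<alpha> * mon \<alpha> x\<bar> \<le> B" and \<alpha>: "\<alpha> \<in> insert a A" for c B \<alpha>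
  proof (cases "\<alpha> = a")
    case True
    have "\<bar>c a * mon a x\<bar> \<le> \<bar>\<Sum>\<alpha>\<in>insert a A. c \<alpha> * mon \<alpha> x\<bar> + \<bar>\<Sum>\<alpha>\<in>A. c \<alpha> * mon \<alpha> x\<bar>"
      using insert.hyps by simp
    also have "\<dots> \<le> B + (\<Sum>\<alpha>\<in>A. \<bar>c \<alpha> * mon \<alpha> x\<bar>)"
      using c x by (intro add_mono sum_abs) auto
    also have "(\<Sum>\<alpha>\<in>A. \<bar>c \<alpha> * mon \<alpha> x\<bar>) \<le> (\<Sum>\<alpha>\<in>A. r \<alpha> * B * \<bar>mon \<alpha> x\<bar>)"
      unfolding abs_mult using r(2)[OF _ c] by (intro sum_mono mult_right_mono) auto
    also have "B + \<dots> = ra * B * \<bar>mon a x\<bar>"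
      using x(2) by (simp add: ra_def field_simps sum_distrib_left)
    finally have "\<bar>c a\<bar> \<le> ra * B"
      using x(2) by (simp add: abs_mult)
    also have "\<dots> \<le> R * B" using R(2) B0[OF c] by (rule mult_right_mono)
    finally show ?thesis using True by simp
  next
    case False
    then have "\<bar>c \<alpha>\<bar> \<le> r \<alpha> * B" using r(2)[OF _ c] \<alpha> by auto
    also have "\<dots> \<le> R * B" using R(3) \<alpha> False B0[OF c] by (intro mult_right_mono) auto
    finally show ?thesis .
  qed
  with R(1) show ?case by blast
qed

lemma poly_nonzero_on_open:
  fixes p :: "('n::finite) rpoly"
  assumes "p \<noteq> 0" "open U" "U \<noteq> {}"
  shows "\<exists>x\<in>U. peval p x \<noteq> 0"
proof (rule ccontr)
  assume "\<not> ?thesis"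
  then have "\<forall>x\<in>U. \<bar>\<Sum>\<alpha>\<in>keys p. lookup p \<alpha> * mon \<alpha> x\<bar> \<le> 0"
    by (simp add: peval_keys)
  moreover obtain R where "\<forall>c B. (\<forall>x\<in>U. \<bar>\<Sum>\<alpha>\<in>keys p. c \<alpha> * mon \<alpha> x\<bar> \<le> B) \<longrightarrow>
      (\<forall>\<alpha>\<in>keys p. \<bar>c \<alpha>\<bar> \<le> R * B)"
    using coefficient_bound[OF finite_keys[of p] assms(2,3)] by blast
  ultimately have "\<forall>\<alpha>\<in>keys p. \<bar>lookup p \<alpha>\<bar> \<le> R * 0"
    by blast
  then have "keys p = {}" by (fastforce simp: in_keys_iff)
  with assms(1) show False by (simp only: keys_eq_empty)
qed

lemma polys_nonzero_on_open:
  fixes P :: "('n::finite) rpoly set"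
  assumes "finite P" "0 \<notin> P" "open U" "U \<noteq> {}"
  shows "\<exists>x\<in>U. \<forall>p\<in>P. peval p x \<noteq> 0"
  using assms
proof (induction P arbitrary: U rule: finite_induct)
  case (insert p P)
  let ?V = "U \<inter> peval p -` (- {0})"
  have "open (peval p -` (- {0}))"
    by (intro open_vimage continuous_intros)
  then have "open ?V" using insert.prems by auto
  moreover have "?V \<noteq> {}"
    using poly_nonzero_on_open[of p U] insert.prems by auto
  ultimately show ?case
    using insert.IH[of ?V] insert.prems by auto
qed auto

section \<open>Degree bounds from domination on a tentacle\<close>

definition leading_form :: "int ^ 'n::finite \<Rightarrow> int \<Rightarrow> 'n rpoly \<Rightarrow> 'n rpoly"
  where "leading_form z D p = (\<Sum>\<alpha> | \<alpha> \<in> keys p \<and> wdeg z \<alpha> = D. single \<alpha> (lookup p \<alpha>))"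

lemma leading_form_nonzero:
  assumes "\<alpha> \<in> keys p"
  shows "leading_form z (wdeg z \<alpha>) p \<noteq> 0"
proof -
  have "lookup (leading_form z (wdeg z \<alpha>) p) \<alpha> = lookup p \<alpha>"
    using assms by (simp add: leading_form_def lookup_sum lookup_single when_def)
  with assms show ?thesis by (auto simp: in_keys_iff)
qed

lemma leading_form_eq_0:
  assumes "\<And>\<alpha>. \<alpha> \<in> keys p \<Longrightarrow> wdeg z \<alpha> < D"
  shows "leading_form z D p = 0"
proof -
  have "{\<alpha>. \<alpha> \<in> keys p \<and> wdeg z \<alpha> = D} = {}" using assms by fastforce
  then show ?thesis by (simp only: leading_form_def sum.empty)
qed

text \<open>
  After division by \<open>l\<^sup>D\<close> a monomial of degree \<open>d\<close> carries the factor \<open>l\<^sup>d\<^sup>-\<^sup>D\<close>, which tends to \<open>0\<close>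
  unless \<open>d = D\<close>.
\<close>
lemma tendsto_leading_form:
  assumes "\<And>\<alpha>. \<alpha> \<in> keys p \<Longrightarrow> wdeg z \<alpha> \<le> D"
  shows "((\<lambda>l. l powi (- D) * peval p (stretch l z x)) \<longlongrightarrow> peval (leading_form z D p) x) at_top"
proof -
  have "((\<lambda>l::real. l powi k) \<longlongrightarrow> (if k = 0 then 1 else 0)) at_top" if "k \<le> 0" for k :: int
  proof (cases "k = 0")
    case False
    then have "0 < nat (- k)" using that by auto
    moreover have "((\<lambda>l::real. inverse l ^ nat (- k)) \<longlongrightarrow> 0 ^ nat (-k)) at_top"
      by (intro tendsto_power tendsto_inverse_0_at_top filterlim_ident)
    moreover have "(\<lambda>l::real. l powi k) = (\<lambda>l. inverse l ^ nat (- k))"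
      using False that by (auto simp: power_int_def)
    ultimately show ?thesis
      using False by (simp only: zero_power if_False)
  qed auto
  note lim = this
  have "((\<lambda>l. \<Sum>\<alpha>\<in>keys p. lookup p \<alpha> * mon \<alpha> x * l powi (wdeg z \<alpha> - D)) \<longlongrightarrow>
      (\<Sum>\<alpha>\<in>keys p. lookup p \<alpha> * mon \<alpha> x * (if wdeg z \<alpha> - D = 0 then 1 else 0))) at_top"
    using assms by (intro tendsto_sum tendsto_mult tendsto_const lim) auto
  also have "(\<Sum>\<alpha>\<in>keys p. lookup p \<alpha> * mon \<alpha> x * (if wdeg z \<alpha> - D = 0 then 1 else 0))
      = peval (leading_form z D p) x"
    unfolding leading_form_def peval_sum peval_single
    by (subst sum.inter_filter) (auto intro!: sum.cong)
  finally show ?thesis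
  proof (rule Lim_transform_eventually)
    show "\<forall>\<^sub>F l in at_top. (\<Sum>\<alpha>\<in>keys p. lookup p \<alpha> * mon \<alpha> x * l powi (wdeg z \<alpha> - D))
        = l powi (- D) * peval p (stretch l z x)"
      using eventually_gt_at_top[of 0]
    proof eventually_elim
      case (elim l)
      then show ?case
        unfolding peval_keys sum_distrib_left
        by (intro sum.cong) (auto simp: mon_stretch power_int_diff power_int_minus field_simps)
    qed
  qed
qed

text \<open>
  The central estimate: if \<open>a\<^sup>2 h\<close> is dominated by \<open>f\<close> on the tentacle, then \<open>2 deg a + deg h\<close> is at
  most \<open>deg f\<close>. Otherwise, dividing by \<open>l\<close> to the power \<open>2 deg a + deg h\<close> makes the right-hand side
  vanish in the limit, so the product of the leading forms of \<open>a\<^sup>2\<close> and \<open>h\<close> vanishes on \<open>K\<close>, although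
  neither form is the zero polynomial and \<open>K\<close> has interior points.
\<close>
lemma wdeg_bound_of_dominated:
  fixes a f h :: "('n::finite) rpoly"
  assumes int: "interior K \<noteq> {}"
    and h: "h \<noteq> 0"
    and dom: "\<And>x. x \<in> tentacle K z \<Longrightarrow> \<bar>(peval a x)\<^sup>2 * peval h x\<bar> \<le> \<bar>peval f x\<bar>"
    and D: "\<And>\<alpha>. \<alpha> \<in> keys f \<Longrightarrow> wdeg z \<alpha> \<le> D"
    and \<alpha>: "\<alpha> \<in> keys a"
  shows "\<exists>\<gamma>\<in>keys h. 2 * wdeg z \<alpha> + wdeg z \<gamma> \<le> D"
proof (rule ccontr)
  assume contra: "\<not> ?thesis"
  have "\<exists>\<beta>\<in>keys p. \<forall>\<alpha>\<in>keys p. wdeg z \<alpha> \<le> wdeg z \<beta>" if "p \<noteq> 0" for p :: "'n rpoly"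
  proof -
    have "Max (wdeg z ` keys p) \<in> wdeg z ` keys p" using that by (intro Max_in) auto
    then obtain \<beta> where "\<beta> \<in> keys p" "wdeg z \<beta> = Max (wdeg z ` keys p)" by auto
    then show ?thesis by (intro bexI[of _ \<beta>]) auto
  qed
  then obtain \<beta> \<gamma> where \<beta>: "\<beta> \<in> keys a" "\<And>\<alpha>. \<alpha> \<in> keys a \<Longrightarrow> wdeg z \<alpha> \<le> wdeg z \<beta>"
    and \<gamma>: "\<gamma> \<in> keys h" "\<And>\<alpha>. \<alpha> \<in> keys h \<Longrightarrow> wdeg z \<alpha> \<le> wdeg z \<gamma>"
    using h \<alpha> by (metis keys_eq_empty empty_iff)
  define E where "E = wdeg z \<beta>"
  define F where "F = wdeg z \<gamma>"
  have less: "D < 2 * E + F"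
    using contra \<alpha> \<beta> \<gamma> unfolding E_def F_def by fastforce
  let ?a = "leading_form z E a" and ?h = "leading_form z F h"
  have zero: "(peval ?a x)\<^sup>2 * peval ?h x = 0" if x: "x \<in> interior K" for x
  proof -
    let ?s = "\<lambda>l. stretch l z x"
    have "((\<lambda>l. (l powi (- E) * peval a (?s l))\<^sup>2 * (l powi (- F) * peval h (?s l)))
        \<longlongrightarrow> (peval ?a x)\<^sup>2 * peval ?h x) at_top"
      using \<beta> \<gamma> by (intro tendsto_intros tendsto_leading_form) (auto simp: E_def F_def)
    moreover have "((\<lambda>l. (l powi (- E) * peval a (?s l))\<^sup>2 * (l powi (- F) * peval h (?s l))) \<longlongrightarrow> 0) at_top"
    proof (rule Lim_null_comparison)
      have "((\<lambda>l. l powi (- (2 * E + F)) * peval f (?s l)) \<longlongrightarrow> peval (leading_form z (2 * E + F) f) x) at_top"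
        using D less by (intro tendsto_leading_form) fastforce
      moreover have "leading_form z (2 * E + F) f = 0"
        using D less by (intro leading_form_eq_0) fastforce
      ultimately show "((\<lambda>l. \<bar>l powi (- (2 * E + F)) * peval f (?s l)\<bar>) \<longlongrightarrow> 0) at_top"
        by (simp add: tendsto_rabs_zero)
      show "\<forall>\<^sub>F l in at_top. norm ((l powi (- E) * peval a (?s l))\<^sup>2 * (l powi (- F) * peval h (?s l)))
          \<le> \<bar>l powi (- (2 * E + F)) * peval f (?s l)\<bar>"
        using eventually_ge_at_top[of 1]
      proof eventually_elim
        case (elim l)
        then have "?s l \<in> tentacle K z"
          using x interior_subset unfolding tentacle_stretch by blast
        from dom[OF this] have "\<bar>l powi (- (2 * E + F))\<bar> * \<bar>(peval a (?s l))\<^sup>2 * peval h (?s l)\<bar>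
            \<le> \<bar>l powi (- (2 * E + F))\<bar> * \<bar>peval f (?s l)\<bar>"
          by (intro mult_left_mono) auto
        moreover have "l powi (- (2 * E + F)) = (l powi (- E))\<^sup>2 * l powi (- F)"
        proof -
          have "l powi (- (2 * E + F)) = l powi (- E + - E + - F)" by (simp add: algebra_simps)
          moreover have "l \<noteq> 0" using elim by auto
          ultimately show ?thesis by (simp only: power_int_add power2_eq_square simp_thms)
        qed
        ultimately show ?case
          by (simp add: abs_mult power_mult_distrib ac_simps)
      qed
    qed
    ultimately show ?thesis
      by (rule tendsto_unique[OF trivial_limit_at_top_linorder])
  qed
  have "\<exists>x\<in>interior K. \<forall>p\<in>{?a, ?h}. peval p x \<noteq> 0"
    using leading_form_nonzero[OF \<beta>(1)] leading_form_nonzero[OF \<gamma>(1)] int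
    by (intro polys_nonzero_on_open) (auto simp: E_def F_def)
  with zero show False by auto
qed

section \<open>A theorem of alternatives over the integers\<close>

lemma wdeg_scale: "wdeg z (k *s \<alpha>) = int k * wdeg z \<alpha>"
  by (simp add: wdeg_def sum_distrib_left algebra_simps)

lemma separating_value:
  fixes A B :: "rat set"
  assumes "finite A" "finite B" "A \<noteq> {}" "\<And>a b. a \<in> A \<Longrightarrow> b \<in> B \<Longrightarrow> a < b"
  shows "\<exists>q. (\<forall>a\<in>A. a < q) \<and> (\<forall>b\<in>B. q < b)"
proof (cases "B = {}")
  case True
  then show ?thesis
    using assms gt_ex[of "Max A"] by (metis Max_less_iff empty_iff)
next
  case False
  with assms have "Max A < Min B" by simp
  then obtain q where "Max A < q" "q < Min B" using dense by blast
  with assms False show ?thesis by auto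
qed

text \<open>
  A theorem of alternatives of Gordan's type, over the integers. It is proved by
  Fourier-Motzkin elimination on the functional \<open>\<psi>\<close> of the last direction: every pair of
  generators on which \<open>\<psi>\<close> has opposite signs is replaced by its positive combination on which \<open>\<psi>\<close>
  vanishes. A functional that is positive on the new generators can be corrected by a multiple of
  \<open>\<psi>\<close> so as to be positive on the old ones, because the constraints on the ratio of the two
  multipliers are compatible. The abstract set \<open>C\<close> makes the second alternative survive the
  induction: it shrinks to the part on which \<open>\<psi>\<close> is nonpositive.
\<close>
lemma additive_alternative:
  fixes G C :: "(nat ^ 'n::finite) set" and z :: "nat \<Rightarrow> int ^ 'n"
  assumes "finite G" "G \<subseteq> C"
    and "\<And>\<alpha> \<beta>. \<alpha> \<in> C \<Longrightarrow> \<beta> \<in> C \<Longrightarrow> \<alpha> + \<beta> \<in> C"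
    and "\<And>k \<alpha>. 0 < k \<Longrightarrow> \<alpha> \<in> C \<Longrightarrow> k *s \<alpha> \<in> C"
  shows "(\<exists>r::nat \<Rightarrow> nat. \<forall>g\<in>G. 0 < (\<Sum>j = 1..m. int (r j) * wdeg (z j) g)) \<or>
    (\<exists>\<alpha>\<in>C. \<forall>j\<in>{1..m}. wdeg (z j) \<alpha> \<le> 0)"
  using assms
proof (induction m arbitrary: G C)
  case 0
  then show ?case by (cases "G = {}") auto
next
  case (Suc m)
  define \<psi> where "\<psi> = wdeg (z (Suc m))"
  have \<psi>: "\<psi> (\<alpha> + \<beta>) = \<psi> \<alpha> + \<psi> \<beta>" "\<psi> (k *s \<alpha>) = int k * \<psi> \<alpha>" for \<alpha> \<beta> k
    by (simp_all add: \<psi>_def wdeg_add wdeg_scale)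
  define C' where "C' = {\<alpha>\<in>C. \<psi> \<alpha> \<le> 0}"
  define cancel where "cancel g h = nat (\<psi> g) *s h + nat (- \<psi> h) *s g" for g h
  define G' where "G' = {g\<in>G. \<psi> g \<le> 0} \<union> (\<lambda>(g, h). cancel g h) ` ({g\<in>G. 0 < \<psi> g} \<times> {h\<in>G. \<psi> h < 0})"
  have "finite G'"
    using Suc.prems(1) by (auto simp: G'_def)
  moreover have "G' \<subseteq> C'"
  proof -
    have "cancel g h \<in> C'" if "g \<in> G" "h \<in> G" "0 < \<psi> g" "\<psi> h < 0" for g h
    proof -
      have "cancel g h \<in> C"
        unfolding cancel_def using that Suc.prems(2)
        by (intro Suc.prems(3) Suc.prems(4)) auto
      moreover have "\<psi> (cancel g h) = 0"
        using that by (simp add: cancel_def \<psi>)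
      ultimately show ?thesis by (simp add: C'_def)
    qed
    then show ?thesis using Suc.prems(2) by (auto simp: G'_def C'_def)
  qed
  moreover have "\<alpha> + \<beta> \<in> C'" if "\<alpha> \<in> C'" "\<beta> \<in> C'" for \<alpha> \<beta>
    using that Suc.prems(3) by (auto simp: C'_def \<psi>)
  moreover have "k *s \<alpha> \<in> C'" if "0 < k" "\<alpha> \<in> C'" for k \<alpha>
    using that Suc.prems(4) by (auto simp: C'_def \<psi> mult_nonneg_nonpos)
  ultimately consider
      (pos) r :: "nat \<Rightarrow> nat" where "\<And>g. g \<in> G' \<Longrightarrow> 0 < (\<Sum>j = 1..m. int (r j) * wdeg (z j) g)"
    | (nonpos) \<alpha> where "\<alpha> \<in> C'" "\<forall>j\<in>{1..m}. wdeg (z j) \<alpha> \<le> 0"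
    using Suc.IH[of G' C'] by blast
  then show ?case
  proof cases
    case nonpos
    then have "\<forall>j\<in>{1..Suc m}. wdeg (z j) \<alpha> \<le> 0"
      by (auto simp: C'_def \<psi>_def le_Suc_eq)
    with nonpos show ?thesis by (auto simp: C'_def)
  next
    case pos
    define w where "w g = (\<Sum>j = 1..m. int (r j) * wdeg (z j) g)" for g
    have w_add: "w (\<alpha> + \<beta>) = w \<alpha> + w \<beta>" "w (k *s \<alpha>) = int k * w \<alpha>" for \<alpha> \<beta> k
      by (simp_all add: w_def wdeg_add wdeg_scale distrib_left sum.distrib sum_distrib_left ac_simps)
    have w: "0 < w g" if "g \<in> G" "\<psi> g \<le> 0" for g
      using pos[of g] that by (simp add: w_def G'_def)
    \<comment> \<open>the lower bound on the ratio \<open>q\<close> imposed by \<open>g\<close> lies below the upper bound imposed by \<open>h\<close>\<close>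
    have cross: "0 < \<psi> g * w h - \<psi> h * w g" if "g \<in> G" "h \<in> G" "0 < \<psi> g" "\<psi> h < 0" for g h
    proof -
      have "cancel g h \<in> G'" using that by (auto simp: G'_def)
      then have "0 < w (cancel g h)" using pos by (simp add: w_def)
      then show ?thesis using that by (simp add: cancel_def w_add)
    qed
    let ?lo = "insert 0 ((\<lambda>g. - of_int (w g) / of_int (\<psi> g)) ` {g\<in>G. 0 < \<psi> g}) :: rat set"
    let ?hi = "(\<lambda>h. of_int (w h) / of_int (- \<psi> h)) ` {h\<in>G. \<psi> h < 0} :: rat set"
    have "a < b" if a: "a \<in> ?lo" and b: "b \<in> ?hi" for a b
    proof -
      from b obtain h where h: "h \<in> G" "\<psi> h < 0" "b = of_int (w h) / of_int (- \<psi> h)" by auto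
      from a consider "a = 0" | g where "g \<in> G" "0 < \<psi> g" "a = - of_int (w g) / of_int (\<psi> g)"
        by auto
      then show ?thesis
      proof cases
        case 1
        with h w[of h] show ?thesis by (simp add: divide_pos_neg)
      next
        case 2
        have "of_int (0::int) < (of_int (\<psi> g * w h - \<psi> h * w g) :: rat)"
          using cross[OF 2(1) h(1) 2(2) h(2)] by (simp only: of_int_less_iff)
        also have "\<dots> = - (b * of_int (\<psi> h)) * of_int (\<psi> g) + (a * of_int (\<psi> g)) * of_int (\<psi> h)"
          using 2 h by simp
        also have "\<dots> = (b - a) * (of_int (\<psi> g) * of_int (- \<psi> h))"
          by (simp add: algebra_simps)
        finally show ?thesis
          using 2(2) h(2) by (simp add: zero_less_mult_iff mult_less_0_iff)
      qed
    qed
    then obtain q where q: "\<forall>a\<in>?lo. a < q" "\<forall>b\<in>?hi. q < b"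
      using separating_value[of ?lo ?hi] Suc.prems(1) by auto
    obtain t' s' where ts: "quotient_of q = (t', s')" by (cases "quotient_of q")
    then have s': "s' > 0" "q = of_int t' / of_int s'"
      using quotient_of_denom_pos quotient_of_div by auto
    moreover have "q > 0" using q(1) by auto
    ultimately have t': "t' > 0" by (simp add: zero_less_divide_iff)
    have main: "0 < s' * w g + t' * \<psi> g" if g: "g \<in> G" for g
    proof (cases "\<psi> g" "0::int" rule: linorder_cases)
      case less
      then have "q < of_int (w g) / of_int (- \<psi> g)" using q(2) g by auto
      then have "of_int (0::int) < (of_int (s' * w g + t' * \<psi> g) :: rat)"
        using s' less by (simp add: field_simps)
      then show ?thesis by (simp only: of_int_less_iff)
    next
      case equal
      with w g s' show ?thesis by simp
    next
      case greater
      then have "- of_int (w g) / of_int (\<psi> g) < q" using q(1) g by auto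
      then have "of_int (0::int) < (of_int (s' * w g + t' * \<psi> g) :: rat)"
        using s' greater by (simp add: field_simps)
      then show ?thesis by (simp only: of_int_less_iff)
    qed
    define r' where "r' j = (if j = Suc m then nat t' else nat s' * r j)" for j
    have "(\<Sum>j = 1..Suc m. int (r' j) * wdeg (z j) g) = s' * w g + t' * \<psi> g" for g
      using s' t' by (simp add: r'_def w_def \<psi>_def sum_distrib_left mult.assoc)
    with main show ?thesis by metis
  qed
qed

lemma strictly_positive_combination_or_exponent:
  fixes z :: "nat \<Rightarrow> int ^ 'n::finite"
  shows "(\<exists>r :: nat \<Rightarrow> nat. strictly_positive (\<Sum>j = 1..m. int (r j) *s z j)) \<or>
    (\<exists>\<alpha>. \<alpha> \<noteq> 0 \<and> (\<forall>j\<in>{1..m}. wdeg (z j) \<alpha> \<le> 0))"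
proof -
  have wdeg: "wdeg v (axis i 1) = v $ i" for v :: "int ^ 'n" and i
  proof -
    have "v $ k * int (axis i 1 $ k) = (if k = i then v $ i else 0)" for k
      by (simp add: axis_def)
    then show ?thesis by (simp add: wdeg_def)
  qed
  have "(\<exists>r::nat \<Rightarrow> nat. \<forall>g\<in>range (\<lambda>i. axis i 1). 0 < (\<Sum>j = 1..m. int (r j) * wdeg (z j) g)) \<or>
      (\<exists>\<alpha>\<in>- {0}. \<forall>j\<in>{1..m}. wdeg (z j) \<alpha> \<le> 0)"
  proof (rule additive_alternative)
    show "range (\<lambda>i. axis i 1) \<subseteq> (- {0} :: (nat ^ 'n) set)"
      by (auto simp: axis_eq_0_iff)
  qed (auto simp: vec_eq_iff)
  then show ?thesis
    by (auto simp: strictly_positive_def wdeg simp del: One_nat_def)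
qed

section \<open>Shortening sums of squares\<close>

lemma single_sum: "(\<Sum>i\<in>I. single k (f i)) = single k (\<Sum>i\<in>I. f i)"
  by (induction I rule: infinite_finite_induct) (auto simp: single_add)

text \<open>
  Sums of arbitrarily many squares of polynomials with support in \<open>A\<close> need only \<open>card A\<close> squares.
  This is a Cholesky step for each exponent: if \<open>c\<close> is the vector of coefficients at \<open>\<alpha>\<close> and
  \<open>u = c / \<bar>c\<bar>\<close>, then the square of \<open>b = \<Sum> u\<^sub>l a\<^sub>l\<close> can be split off, since
  \<open>\<Sum> a\<^sub>l\<^sup>2 = b\<^sup>2 + \<Sum> (a\<^sub>l - u\<^sub>l b)\<^sup>2\<close>, and the polynomials \<open>a\<^sub>l - u\<^sub>l b\<close> have lost the exponent \<open>\<alpha>\<close>.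
\<close>
lemma sum_of_squares_shorten:
  fixes a :: "'l \<Rightarrow> ('n::finite) rpoly"
  assumes "finite A" "\<And>l. l \<in> L \<Longrightarrow> a l \<in> supported A"
  shows "\<exists>b. (\<forall>\<alpha>\<in>A. b \<alpha> \<in> supported A) \<and> (\<Sum>l\<in>L. (a l)\<^sup>2) = (\<Sum>\<alpha>\<in>A. (b \<alpha>)\<^sup>2)"
  using assms
proof (induction A arbitrary: a rule: finite_induct)
  case empty
  then show ?case by (simp add: supported_def)
next
  case (insert \<alpha> A)
  have mono: "supported A \<subseteq> supported (insert \<alpha> A)" by (auto simp: supported_def)
  have drop: "p \<in> supported A" if "p \<in> supported (insert \<alpha> A)" "lookup p \<alpha> = 0" for p :: "'n rpoly"
    using that by (auto simp: supported_def in_keys_iff)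
  define c where "c l = lookup (a l) \<alpha>" for l
  define s where "s = sqrt (\<Sum>l\<in>L. (c l)\<^sup>2)"
  have s2: "s\<^sup>2 = (\<Sum>l\<in>L. (c l)\<^sup>2)" by (simp add: s_def sum_nonneg)
  have finish: ?case if b0: "b0 \<in> supported (insert \<alpha> A)" and a': "\<And>l. l \<in> L \<Longrightarrow> a' l \<in> supported A"
    and eq: "(\<Sum>l\<in>L. (a l)\<^sup>2) = b0\<^sup>2 + (\<Sum>l\<in>L. (a' l)\<^sup>2)" for b0 a'
  proof -
    from insert.IH[of a'] a' obtain b where b: "\<forall>\<alpha>\<in>A. b \<alpha> \<in> supported A"
      "(\<Sum>l\<in>L. (a' l)\<^sup>2) = (\<Sum>\<alpha>\<in>A. (b \<alpha>)\<^sup>2)" by blast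
    have "(\<Sum>\<beta>\<in>insert \<alpha> A. ((b(\<alpha> := b0)) \<beta>)\<^sup>2) = b0\<^sup>2 + (\<Sum>\<beta>\<in>A. ((b(\<alpha> := b0)) \<beta>)\<^sup>2)"
      using insert.hyps by simp
    also have "(\<Sum>\<beta>\<in>A. ((b(\<alpha> := b0)) \<beta>)\<^sup>2) = (\<Sum>\<beta>\<in>A. (b \<beta>)\<^sup>2)"
      using insert.hyps by (intro sum.cong) auto
    finally show ?thesis
      using b b0 mono eq by (intro exI[of _ "b(\<alpha> := b0)"]) auto
  qed
  show ?case
  proof (cases "infinite L \<or> s = 0")
    case True
    then have "infinite L \<or> (\<forall>l\<in>L. c l = 0)"
      using s2 by (auto simp: sum_nonneg_eq_0_iff)
    then show ?thesis
    proof
      assume "\<forall>l\<in>L. c l = 0"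
      then show ?thesis
        using insert.prems drop by (intro finish[of 0 a]) (auto simp: c_def)
    next
      assume "infinite L"
      then show ?thesis by (intro finish[of 0 "\<lambda>_. 0"]) auto
    qed
  next
    case False
    define u :: "'l \<Rightarrow> 'n rpoly" where "u l = single 0 (c l / s)" for l
    define b0 where "b0 = (\<Sum>l\<in>L. u l * a l)"
    define a' where "a' l = a l - u l * b0" for l
    have u_mult: "u l * p \<in> supported (insert \<alpha> A)" if "p \<in> supported (insert \<alpha> A)" for l and p :: "'n rpoly"
      using that unfolding u_def by (rule supported_const_mult)
    have b0: "b0 \<in> supported (insert \<alpha> A)"
      unfolding b0_def using insert.prems by (intro supported_sum u_mult)
    have "lookup b0 \<alpha> = (\<Sum>l\<in>L. c l / s * c l)"
      by (simp add: b0_def lookup_sum u_def lookup_const_mult c_def)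
    also have "\<dots> = s\<^sup>2 / s" unfolding s2 by (simp add: sum_divide_distrib power2_eq_square)
    also have "\<dots> = s" by (simp add: power2_eq_square)
    finally have "lookup (a' l) \<alpha> = 0" for l
      using False by (simp add: a'_def lookup_minus u_def lookup_const_mult c_def)
    then have a': "a' l \<in> supported A" if "l \<in> L" for l
      using drop[of "a' l"] that b0 insert.prems unfolding a'_def
      by (meson supported_diff u_mult)
    have "(\<Sum>l\<in>L. (u l)\<^sup>2) = single 0 (\<Sum>l\<in>L. (c l / s)\<^sup>2)"
      by (simp add: u_def power2_eq_square mult_single single_sum)
    also have "(\<Sum>l\<in>L. (c l / s)\<^sup>2) = 1"
      using False by (simp add: power_divide flip: sum_divide_distrib s2)
    finally have u2: "(\<Sum>l\<in>L. (u l)\<^sup>2) = 1" by simp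
    have "(a' l)\<^sup>2 = (a l)\<^sup>2 - 2 * b0 * (u l * a l) + b0\<^sup>2 * (u l)\<^sup>2" for l
      unfolding a'_def by (simp add: power2_eq_square algebra_simps)
    then have "(\<Sum>l\<in>L. (a' l)\<^sup>2) = (\<Sum>l\<in>L. (a l)\<^sup>2) - 2 * b0 * b0 + b0\<^sup>2 * (\<Sum>l\<in>L. (u l)\<^sup>2)"
      by (simp add: sum.distrib sum_subtractf b0_def sum_distrib_left)
    then have "(\<Sum>l\<in>L. (a l)\<^sup>2) = b0\<^sup>2 + (\<Sum>l\<in>L. (a' l)\<^sup>2)"
      unfolding u2 by (simp add: power2_eq_square algebra_simps)
    with b0 a' show ?thesis by (rule finish)
  qed
qed

lemma sums_of_squares_supported:
  fixes \<sigma> :: "('n::finite) rpoly"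
  assumes "finite A"
  shows "\<sigma> \<in> sums_of_squares (supported A) \<longleftrightarrow>
    (\<exists>b. (\<forall>\<alpha>\<in>A. b \<alpha> \<in> supported A) \<and> \<sigma> = (\<Sum>\<alpha>\<in>A. (b \<alpha>)\<^sup>2))" (is "?L \<longleftrightarrow> ?R")
proof
  assume ?L
  then obtain as where as: "set as \<subseteq> supported A" "\<sigma> = (\<Sum>a\<leftarrow>as. a\<^sup>2)"
    unfolding sums_of_squares_def by auto
  then have "\<sigma> = (\<Sum>l\<in>{..<length as}. (as ! l)\<^sup>2)"
    by (simp add: sum_list_sum_nth atLeast0LessThan)
  moreover have "as ! l \<in> supported A" if "l \<in> {..<length as}" for l
    using as that nth_mem by blast
  ultimately show ?R
    using sum_of_squares_shorten[OF assms, of "{..<length as}" "\<lambda>l. as ! l"] by auto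
next
  assume ?R
  then obtain b where b: "\<forall>\<alpha>\<in>A. b \<alpha> \<in> supported A" "\<sigma> = (\<Sum>\<alpha>\<in>A. (b \<alpha>)\<^sup>2)" by blast
  obtain xs where xs: "set xs = A" "distinct xs" using finite_distinct_list[OF assms] by blast
  then have "\<sigma> = (\<Sum>a\<leftarrow>map b xs. a\<^sup>2)"
    by (simp add: b(2) sum_list_distinct_conv_sum_set comp_def)
  then show ?L
    unfolding sums_of_squares_def using b xs by (auto intro!: exI[of _ "map b xs"])
qed

text \<open>
  Treating \<open>1\<close> as the generator with index \<open>0\<close> removes the special role of the first sum of
  squares.
\<close>
lemma restricted_QM_iff:
  "p \<in> restricted_QM W fs \<longleftrightarrow>
    (\<exists>\<sigma>. (\<forall>i<Suc (length fs). \<sigma> i \<in> sums_of_squares W) \<and> p = (\<Sum>i<Suc (length fs). \<sigma> i * (1 # fs) ! i))"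
    (is "_ \<longleftrightarrow> ?R")
proof
  assume "p \<in> restricted_QM W fs"
  then obtain \<sigma>0 \<sigma> where \<sigma>: "\<sigma>0 \<in> sums_of_squares W" "\<forall>i<length fs. \<sigma> i \<in> sums_of_squares W"
    "p = \<sigma>0 + (\<Sum>i<length fs. \<sigma> i * fs ! i)"
    unfolding restricted_QM_def by blast
  then show ?R
    by (intro exI[of _ "case_nat \<sigma>0 \<sigma>"])
      (auto simp: sum.lessThan_Suc_shift less_Suc_eq_0_disj simp del: sum.lessThan_Suc split: nat.splits)
next
  assume ?R
  then obtain \<sigma> where \<sigma>: "\<forall>i<Suc (length fs). \<sigma> i \<in> sums_of_squares W"
    "p = (\<Sum>i<Suc (length fs). \<sigma> i * (1 # fs) ! i)" by blast
  then have "p = \<sigma> 0 + (\<Sum>i<length fs. \<sigma> (Suc i) * fs ! i)"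
    by (simp add: sum.lessThan_Suc_shift del: sum.lessThan_Suc)
  with \<sigma>(1) show "p \<in> restricted_QM W fs"
    unfolding restricted_QM_def by (auto intro!: exI[of _ "\<sigma> 0"] exI[of _ "\<lambda>i. \<sigma> (Suc i)"])
qed

lemma restricted_QM_supported:
  fixes p :: "('n::finite) rpoly"
  assumes "finite A"
  shows "p \<in> restricted_QM (supported A) fs \<longleftrightarrow>
    (\<exists>b. (\<forall>i<Suc (length fs). \<forall>\<alpha>\<in>A. b i \<alpha> \<in> supported A) \<and>
      p = (\<Sum>i<Suc (length fs). (\<Sum>\<alpha>\<in>A. (b i \<alpha>)\<^sup>2) * (1 # fs) ! i))" (is "?L \<longleftrightarrow> ?R")
proof
  assume ?L
  then obtain \<sigma> where \<sigma>: "\<forall>i<Suc (length fs). \<sigma> i \<in> sums_of_squares (supported A)"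
    "p = (\<Sum>i<Suc (length fs). \<sigma> i * (1 # fs) ! i)"
    unfolding restricted_QM_iff by blast
  then have "\<forall>i\<in>{..<Suc (length fs)}. \<exists>b. (\<forall>\<alpha>\<in>A. b \<alpha> \<in> supported A) \<and> \<sigma> i = (\<Sum>\<alpha>\<in>A. (b \<alpha>)\<^sup>2)"
    by (simp add: sums_of_squares_supported[OF assms])
  from bchoice[OF this] obtain b where
    "\<forall>i\<in>{..<Suc (length fs)}. (\<forall>\<alpha>\<in>A. b i \<alpha> \<in> supported A) \<and> \<sigma> i = (\<Sum>\<alpha>\<in>A. (b i \<alpha>)\<^sup>2)"
    by blast
  with \<sigma>(2) show ?R by (intro exI[of _ b]) (auto intro!: sum.cong)
next
  assume ?R
  then obtain b where "\<forall>i<Suc (length fs). \<forall>\<alpha>\<in>A. b i \<alpha> \<in> supported A"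
    "p = (\<Sum>i<Suc (length fs). (\<Sum>\<alpha>\<in>A. (b i \<alpha>)\<^sup>2) * (1 # fs) ! i)" by blast
  then show ?L
    unfolding restricted_QM_iff sums_of_squares_supported[OF assms]
    by (intro exI[of _ "\<lambda>i. \<Sum>\<alpha>\<in>A. (b i \<alpha>)\<^sup>2"]) auto
qed

section \<open>Limits of weighted sums of squares\<close>

lemma bounded_coordinates_subsequence:
  fixes f :: "nat \<Rightarrow> 'b \<Rightarrow> real"
  assumes "finite I" "\<And>n k. k \<in> I \<Longrightarrow> \<bar>f n k\<bar> \<le> C"
  obtains l r where "strict_mono (r :: nat \<Rightarrow> nat)" "\<And>k. k \<in> I \<Longrightarrow> (\<lambda>n. f (r n) k) \<longlonglongrightarrow> l k"
proof -
  have "\<forall>d\<subseteq>I. \<exists>l::'b \<Rightarrow> real. \<exists>r::nat \<Rightarrow> nat. strict_mono r \<and>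
      (\<forall>e>0. eventually (\<lambda>n. \<forall>i\<in>d. dist (f (r n) i) (l i) < e) sequentially)"
    by (rule compact_lemma_general[where proj = "\<lambda>x k. x k" and unproj = "\<lambda>x. x"])
      (use assms in \<open>auto simp: bounded_iff\<close>)
  then obtain l r where "strict_mono r"
    and lim: "\<And>e. e > 0 \<Longrightarrow> eventually (\<lambda>n. \<forall>i\<in>I. dist (f (r n) i) (l i) < e) sequentially"
    by blast
  moreover have "(\<lambda>n. f (r n) k) \<longlonglongrightarrow> l k" if "k \<in> I" for k
  proof (rule tendstoI)
    fix e :: real assume "e > 0"
    from lim[OF this] show "\<forall>\<^sub>F n in sequentially. dist (f (r n) k) (l k) < e"
      by eventually_elim (use that in auto)
  qed
  ultimately show thesis using that by blast
qed

text \<open>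
  Where the weights are at least \<open>\<delta>\<close>, every summand is bounded by the whole sum, so the squared
  polynomials are uniformly bounded on \<open>U\<close>, hence so are their coefficients; a convergent subsequence
  of the coefficients gives the representation of the limit. The weights may vary with \<open>k\<close>:
  closedness of the quadratic module uses constant weights, the failure of the Strong Moment
  Property uses rescaled generators.
\<close>
lemma weighted_squares_limit:
  fixes U :: "(real ^ 'n::finite) set" and b :: "nat \<Rightarrow> 'j \<Rightarrow> 'n rpoly"
  assumes A: "finite A" and J: "finite J" and U: "open U" "U \<noteq> {}" and "\<delta> > 0"
    and b: "\<And>k j. j \<in> J \<Longrightarrow> b k j \<in> supported A"
    and g: "\<And>k x. g k x = (\<Sum>j\<in>J. (peval (b k j) x)\<^sup>2 * h k j x)"
    and h: "\<And>k j x. j \<in> J \<Longrightarrow> x \<in> U \<Longrightarrow> \<delta> \<le> h k j x"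
    and bound: "\<And>k x. x \<in> U \<Longrightarrow> g k x \<le> C"
    and limg: "\<And>x. (\<lambda>k. g k x) \<longlonglongrightarrow> G x"
    and limh: "\<And>j x. j \<in> J \<Longrightarrow> (\<lambda>k. h k j x) \<longlonglongrightarrow> H j x"
  shows "\<exists>B. (\<forall>j\<in>J. B j \<in> supported A) \<and> (\<forall>x. G x = (\<Sum>j\<in>J. (peval (B j) x)\<^sup>2 * H j x))"
proof -
  from coefficient_bound[OF A U] obtain R where R:
    "\<And>c B \<alpha>. (\<forall>x\<in>U. \<bar>\<Sum>\<alpha>\<in>A. c \<alpha> * mon \<alpha> x\<bar> \<le> B) \<Longrightarrow> \<alpha> \<in> A \<Longrightarrow> \<bar>c \<alpha>\<bar> \<le> R * B"
    by blast
  have peval_b: "peval (b k j) x = (\<Sum>\<alpha>\<in>A. lookup (b k j) \<alpha> * mon \<alpha> x)" if "j \<in> J" for k j x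
    using b[OF that] A by (intro peval_alt) (auto simp: supported_def)
  have coeff: "\<bar>lookup (b k j) \<alpha>\<bar> \<le> R * sqrt (C / \<delta>)" if j: "j \<in> J" and \<alpha>: "\<alpha> \<in> A" for k j \<alpha>
  proof (rule R[OF _ \<alpha>], rule ballI)
    fix x assume x: "x \<in> U"
    have nonneg: "0 \<le> (peval (b k i) x)\<^sup>2 * h k i x" if "i \<in> J" for i
      using h[OF that x, of k] \<open>\<delta> > 0\<close> by simp
    have "(peval (b k j) x)\<^sup>2 * \<delta> \<le> (peval (b k j) x)\<^sup>2 * h k j x"
      using h[OF j x] by (intro mult_left_mono) auto
    also have "\<dots> \<le> g k x"
      unfolding g using nonneg j J by (intro member_le_sum) auto
    also have "\<dots> \<le> C" by (rule bound[OF x])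
    finally have "(peval (b k j) x)\<^sup>2 \<le> C / \<delta>"
      using \<open>\<delta> > 0\<close> by (simp add: field_simps)
    then have "\<bar>peval (b k j) x\<bar> \<le> sqrt (C / \<delta>)"
      by (intro real_le_rsqrt) simp
    then show "\<bar>\<Sum>\<alpha>\<in>A. lookup (b k j) \<alpha> * mon \<alpha> x\<bar> \<le> sqrt (C / \<delta>)"
      by (simp add: peval_b[OF j])
  qed
  obtain l r where r: "strict_mono (r :: nat \<Rightarrow> nat)"
    and l: "\<And>p. p \<in> J \<times> A \<Longrightarrow> (\<lambda>n. lookup (b (r n) (fst p)) (snd p)) \<longlonglongrightarrow> l p"
  proof (rule bounded_coordinates_subsequence[of "J \<times> A" "\<lambda>n p. lookup (b n (fst p)) (snd p)"])
    show "finite (J \<times> A)" using A J by simp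
    show "\<bar>lookup (b n (fst p)) (snd p)\<bar> \<le> R * sqrt (C / \<delta>)" if "p \<in> J \<times> A" for n p
      using that coeff by auto
  qed blast
  have "\<exists>B. B \<in> supported A \<and> (\<forall>x. peval B x = (\<Sum>\<alpha>\<in>A. l (j, \<alpha>) * mon \<alpha> x))" for j
    by (rule supported_peval[OF A, of "\<lambda>\<alpha>. l (j, \<alpha>)"]) blast
  then have "\<exists>B. \<forall>j. B j \<in> supported A \<and> (\<forall>x. peval (B j) x = (\<Sum>\<alpha>\<in>A. l (j, \<alpha>) * mon \<alpha> x))"
    by (intro choice allI)
  then obtain B where B: "\<And>j. B j \<in> supported A"
    "\<And>j x. peval (B j) x = (\<Sum>\<alpha>\<in>A. l (j, \<alpha>) * mon \<alpha> x)"
    by blast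
  have "G x = (\<Sum>j\<in>J. (peval (B j) x)\<^sup>2 * H j x)" for x
  proof (rule LIMSEQ_unique)
    show "(\<lambda>k. g (r k) x) \<longlonglongrightarrow> G x"
      using LIMSEQ_subseq_LIMSEQ[OF limg r] by (simp add: comp_def)
    have "(\<lambda>k. peval (b (r k) j) x) \<longlonglongrightarrow> peval (B j) x" if "j \<in> J" for j
      unfolding peval_b[OF that] B(2) using l that by (intro tendsto_intros) force
    moreover have "(\<lambda>k. h (r k) j x) \<longlonglongrightarrow> H j x" if "j \<in> J" for j
      using LIMSEQ_subseq_LIMSEQ[OF limh[OF that] r] by (simp add: comp_def)
    ultimately show "(\<lambda>k. g (r k) x) \<longlonglongrightarrow> (\<Sum>j\<in>J. (peval (B j) x)\<^sup>2 * H j x)"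
      unfolding g by (intro tendsto_intros) auto
  qed
  with B(1) show ?thesis by blast
qed

lemma positive_on_ball:
  fixes P :: "('n::finite) rpoly set"
  assumes "finite P" "\<And>p. p \<in> P \<Longrightarrow> 0 < peval p x0"
  shows "\<exists>e>0. \<exists>\<delta>>0. \<forall>p\<in>P. \<forall>x\<in>ball x0 e. \<delta> \<le> peval p x"
proof -
  have "\<forall>\<^sub>F x in at x0. peval p x0 / 2 < peval p x" if "p \<in> P" for p
  proof -
    have "(peval p \<longlongrightarrow> peval p x0) (at x0)"
      using continuous_on_peval[of UNIV p] by (simp add: continuous_on_eq_continuous_at isCont_def)
    then show ?thesis using assms(2)[OF that] by (intro order_tendstoD) auto
  qed
  then have "\<forall>\<^sub>F x in at x0. \<forall>p\<in>P. peval p x0 / 2 < peval p x"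
    using assms(1) by (intro eventually_ball_finite) auto
  then obtain e where e: "e > 0"
    "\<And>x. x \<noteq> x0 \<Longrightarrow> dist x x0 < e \<Longrightarrow> \<forall>p\<in>P. peval p x0 / 2 < peval p x"
    unfolding eventually_at by auto
  define \<delta> where "\<delta> = Min (insert 1 ((\<lambda>p. peval p x0 / 2) ` P))"
  have \<delta>: "\<delta> > 0" "\<And>p. p \<in> P \<Longrightarrow> \<delta> \<le> peval p x0 / 2"
  proof -
    show "\<delta> > 0" using assms by (auto simp: \<delta>_def)
    show "\<delta> \<le> peval p x0 / 2" if "p \<in> P" for p
      unfolding \<delta>_def using assms(1) that by (intro Min_le) auto
  qed
  have "\<delta> \<le> peval p x" if "p \<in> P" "x \<in> ball x0 e" for p x
  proof (cases "x = x0")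
    case True
    with \<delta>(2)[OF that(1)] assms(2)[OF that(1)] show ?thesis by simp
  next
    case False
    with e(2)[of x] that \<delta>(2)[OF that(1)] show ?thesis by (force simp: dist_commute)
  qed
  with e(1) \<delta>(1) show ?thesis by blast
qed

lemma peval_inject:
  assumes "\<And>x. peval p x = peval q x"
  shows "p = q"
  using poly_nonzero_on_open[of "p - q" UNIV] assms by (auto simp: peval_diff)

section \<open>Quadratic modules nonnegative on enough tentacles\<close>

lemma mem_QM:
  assumes "f \<in> set (1 # fs)"
  shows "f \<in> QM fs"
proof -
  obtain k where k: "k < Suc (length fs)" "(1 # fs) ! k = f"
    using assms by (metis in_set_conv_nth length_Cons)
  have "(if i = k then 1 else 0) \<in> sums_of_squares UNIV" for i :: nat
    unfolding sums_of_squares_def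
    by (auto intro: exI[of _ "[1]"] exI[of _ "[]"])
  moreover have "f = (\<Sum>i<Suc (length fs). (if i = k then 1 else 0) * (1 # fs) ! i)"
  proof -
    have "(if i = k then 1 else 0) * (1 # fs) ! i = (if i = k then f else 0)" for i
      using k by auto
    then show ?thesis using k(1) by (simp del: sum.lessThan_Suc)
  qed
  ultimately show ?thesis
    unfolding QM_def restricted_QM_iff by (intro exI[of _ "\<lambda>i. if i = k then 1 else 0"]) blast
qed

lemma sums_of_squares_mono: "V \<subseteq> W \<Longrightarrow> sums_of_squares V \<subseteq> sums_of_squares W"
  unfolding sums_of_squares_def by blast

lemma restricted_QM_subset_QM: "restricted_QM W fs \<subseteq> QM fs"
  unfolding QM_def restricted_QM_def using sums_of_squares_mono[of W UNIV] by blast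

lemma finite_nonneg_upper_bound:
  fixes f :: "'a \<Rightarrow> int"
  assumes "finite X"
  shows "\<exists>D\<ge>0. \<forall>x\<in>X. f x \<le> D"
proof (intro exI conjI ballI)
  show "0 \<le> Max (insert 0 (f ` X))"
    by (rule Max_ge) (use assms in auto)
  show "f x \<le> Max (insert 0 (f ` X))" if "x \<in> X" for x
    by (rule Max_ge) (use assms that in auto)
qed

lemma finite_bounded_exponents: "finite {\<alpha> :: nat ^ 'n::finite. \<forall>i. \<alpha> $ i \<le> N}"
proof (rule finite_imageD)
  have "vec_nth ` {\<alpha> :: nat ^ 'n. \<forall>i. \<alpha> $ i \<le> N} \<subseteq> (UNIV \<rightarrow>\<^sub>E {..N})"
    by auto
  then show "finite (vec_nth ` {\<alpha> :: nat ^ 'n. \<forall>i. \<alpha> $ i \<le> N})"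
    by (rule finite_subset) (intro finite_PiE; simp)
  show "inj_on vec_nth {\<alpha> :: nat ^ 'n. \<forall>i. \<alpha> $ i \<le> N}"
    by (simp add: inj_on_def vec_nth_inject)
qed

lemma wdeg_combination:
  "wdeg (\<Sum>j\<in>J. int (r j) *s z j) \<alpha> = (\<Sum>j\<in>J. int (r j) * wdeg (z j) \<alpha>)"
  unfolding wdeg_def
  by (simp add: sum_distrib_left sum_distrib_right mult.assoc) (rule sum.swap)

lemma exponent_le_wdeg:
  assumes "strictly_positive v"
  shows "int (\<alpha> $ i) \<le> wdeg v \<alpha>"
proof -
  have pos: "v $ k > 0" for k using assms by (simp add: strictly_positive_def)
  have "int (\<alpha> $ i) \<le> v $ i * int (\<alpha> $ i)"
    using pos[of i] by (simp add: mult_le_cancel_right1)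
  also have "\<dots> \<le> wdeg v \<alpha>"
    unfolding wdeg_def using pos by (intro member_le_sum) (auto simp: less_imp_le)
  finally show ?thesis .
qed

text \<open>
  Bounds for the degrees in the directions \<open>z j\<close> add up to one for the degree in a strictly
  positive direction, which bounds every component of the exponent.
\<close>
lemma finite_exponents_wdeg_le:
  assumes "strictly_positive (\<Sum>j = 1..m. int (r j) *s z j)"
  shows "finite {\<alpha>. \<forall>j\<in>{1..m}. wdeg (z j) \<alpha> \<le> N}"
proof (rule finite_subset[OF _ finite_bounded_exponents])
  show "{\<alpha>. \<forall>j\<in>{1..m}. wdeg (z j) \<alpha> \<le> N} \<subseteq> {\<alpha>. \<forall>i. \<alpha> $ i \<le> nat (\<Sum>j = 1..m. int (r j) * N)}"
  proof safe
    fix \<alpha> i assume \<alpha>: "\<forall>j\<in>{1..m}. wdeg (z j) \<alpha> \<le> N"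
    have "int (\<alpha> $ i) \<le> (\<Sum>j = 1..m. int (r j) * wdeg (z j) \<alpha>)"
      using exponent_le_wdeg[OF assms] by (simp add: wdeg_combination)
    also have "\<dots> \<le> (\<Sum>j = 1..m. int (r j) * N)"
      using \<alpha> by (intro sum_mono mult_left_mono) auto
    finally show "\<alpha> $ i \<le> nat (\<Sum>j = 1..m. int (r j) * N)" by linarith
  qed
qed

text \<open>
  The set that contains the tentacles enters the arguments only through the nonnegativity of the
  generators on the tentacles.
\<close>
locale positive_tentacles =
  fixes fs :: "('n::finite) rpoly list" and m :: nat
    and K :: "nat \<Rightarrow> (real ^ 'n) set" and z :: "nat \<Rightarrow> int ^ 'n" and r :: "nat \<Rightarrow> nat"
  assumes interior: "\<And>j. j \<in> {1..m} \<Longrightarrow> interior (K j) \<noteq> {}"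
    and nonneg: "\<And>j f x. j \<in> {1..m} \<Longrightarrow> f \<in> set fs \<Longrightarrow> x \<in> tentacle (K j) (z j) \<Longrightarrow> 0 \<le> peval f x"
    and positive: "strictly_positive (\<Sum>j = 1..m. int (r j) *s z j)"
begin

abbreviation gen :: "nat \<Rightarrow> 'n rpoly"
  where "gen i \<equiv> (1 # fs) ! i"

lemma gen_nonneg:
  assumes "i < Suc (length fs)" "j \<in> {1..m}" "x \<in> tentacle (K j) (z j)"
  shows "0 \<le> peval (gen i) x"
proof -
  have "gen i \<in> set (1 # fs)" using assms(1) by (intro nth_mem) simp
  then show ?thesis using nonneg[OF assms(2) _ assms(3)] by auto
qed

text \<open>
  In any representation of \<open>f\<close>, every summand \<open>a\<^sup>2 h\<close> lies between \<open>0\<close> and \<open>f\<close> on each tentacle, so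
  the degree of \<open>a\<close> is bounded in every direction. The multiplier of a zero generator is
  uncontrolled, and is replaced by \<open>0\<close>.
\<close>
lemma certificates_of_bounded_degree:
  assumes A0: "finite A0"
  obtains A where "finite A" "QM fs \<inter> supported A0 \<subseteq> restricted_QM (supported A) fs"
proof -
  let ?X = "{1..m} \<times> A0" and ?Y = "{1..m} \<times> (\<Union>h\<in>set (1 # fs). keys h)"
  have fin: "finite ?X" "finite ?Y" using A0 by auto
  obtain D where "D \<ge> 0" and "\<forall>(j, \<alpha>)\<in>?X. wdeg (z j) \<alpha> \<le> D"
    using finite_nonneg_upper_bound[OF fin(1), of "\<lambda>(j, \<alpha>). wdeg (z j) \<alpha>"]
    by (auto simp: case_prod_beta)
  then have D: "D \<ge> 0" "\<And>j \<alpha>. j \<in> {1..m} \<Longrightarrow> \<alpha> \<in> A0 \<Longrightarrow> wdeg (z j) \<alpha> \<le> D"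
    by blast+
  obtain E where "E \<ge> 0" and "\<forall>(j, \<alpha>)\<in>?Y. - wdeg (z j) \<alpha> \<le> E"
    using finite_nonneg_upper_bound[OF fin(2), of "\<lambda>(j, \<alpha>). - wdeg (z j) \<alpha>"]
    unfolding case_prod_beta by blast
  then have E: "E \<ge> 0" "\<And>j h \<gamma>. j \<in> {1..m} \<Longrightarrow> h \<in> set (1 # fs) \<Longrightarrow> \<gamma> \<in> keys h \<Longrightarrow> - wdeg (z j) \<gamma> \<le> E"
    by blast+
  define A where "A = {\<alpha>. \<forall>j\<in>{1..m}. 2 * wdeg (z j) \<alpha> \<le> D + E}"
  have "A \<subseteq> {\<alpha>. \<forall>j\<in>{1..m}. wdeg (z j) \<alpha> \<le> D + E}"
    using D(1) E(1) by (force simp: A_def)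
  then have "finite A"
    using finite_exponents_wdeg_le[OF positive] by (rule finite_subset)
  moreover have "f \<in> restricted_QM (supported A) fs" if f: "f \<in> QM fs" "f \<in> supported A0" for f
  proof -
    obtain \<sigma> where \<sigma>: "\<forall>i<Suc (length fs). \<sigma> i \<in> sums_of_squares UNIV"
      "f = (\<Sum>i<Suc (length fs). \<sigma> i * gen i)"
      using f(1) unfolding QM_def restricted_QM_iff by blast
    then have "\<forall>i\<in>{..<Suc (length fs)}. \<exists>as. \<sigma> i = (\<Sum>a\<leftarrow>as. a\<^sup>2)"
      unfolding sums_of_squares_def by auto
    from bchoice[OF this] obtain as where as: "\<And>i. i < Suc (length fs) \<Longrightarrow> \<sigma> i = (\<Sum>a\<leftarrow>as i. a\<^sup>2)"
      by auto
    have peval_list: "peval (\<Sum>a\<leftarrow>bs. a\<^sup>2) x = (\<Sum>a\<leftarrow>bs. (peval a x)\<^sup>2)" for bs :: "'n rpoly list" and x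
      by (induction bs) (auto simp: peval_add)
    have small: "a \<in> supported A" if i: "i < Suc (length fs)" "gen i \<noteq> 0" and a: "a \<in> set (as i)" for i a
    proof -
      have "2 * wdeg (z j) \<alpha> \<le> D + E" if j: "j \<in> {1..m}" and \<alpha>: "\<alpha> \<in> keys a" for j \<alpha>
      proof -
        have "\<exists>\<gamma>\<in>keys (gen i). 2 * wdeg (z j) \<alpha> + wdeg (z j) \<gamma> \<le> D"
        proof (rule wdeg_bound_of_dominated[OF interior[OF j] i(2) _ _ \<alpha>])
          fix x assume x: "x \<in> tentacle (K j) (z j)"
          have \<sigma>_nonneg: "0 \<le> peval (\<sigma> k) x" if "k < Suc (length fs)" for k
            unfolding as[OF that] peval_list by (rule sum_list_nonneg) auto
          have "(peval a x)\<^sup>2 \<le> peval (\<sigma> i) x"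
            unfolding as[OF i(1)] peval_list
            by (rule member_le_sum_list) (use a in auto)
          then have "(peval a x)\<^sup>2 * peval (gen i) x \<le> peval (\<sigma> i) x * peval (gen i) x"
            using gen_nonneg[OF i(1) j x] by (rule mult_right_mono)
          also have "\<dots> \<le> (\<Sum>k<Suc (length fs). peval (\<sigma> k) x * peval (gen k) x)"
            using i(1) gen_nonneg[OF _ j x] \<sigma>_nonneg
            by (intro member_le_sum) auto
          also have "\<dots> = peval f x"
            by (simp only: \<sigma>(2) peval_sum peval_mult)
          finally show "\<bar>(peval a x)\<^sup>2 * peval (gen i) x\<bar> \<le> \<bar>peval f x\<bar>"
            using gen_nonneg[OF i(1) j x] by simp
        next
          fix \<beta> assume "\<beta> \<in> keys f"
          with f(2) D(2)[OF j] show "wdeg (z j) \<beta> \<le> D" by (auto simp: supported_def)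
        qed
        moreover have "gen i \<in> set (1 # fs)" using i(1) by (intro nth_mem) simp
        ultimately show ?thesis using E(2)[OF j, of "gen i"] by fastforce
      qed
      then show ?thesis by (auto simp: supported_def A_def)
    qed
    define \<sigma>' where "\<sigma>' i = (if gen i = 0 then 0 else \<sigma> i)" for i
    have "\<sigma>' i \<in> sums_of_squares (supported A)" if i: "i < Suc (length fs)" for i
    proof (cases "gen i = 0")
      case True
      then show ?thesis
        by (auto simp: \<sigma>'_def sums_of_squares_def intro: exI[of _ "[]"])
    next
      case False
      with small[OF i] show ?thesis
        by (auto simp: \<sigma>'_def sums_of_squares_def as[OF i] intro!: exI[of _ "as i"])
    qed
    moreover have "f = (\<Sum>i<Suc (length fs). \<sigma>' i * gen i)"
      unfolding \<sigma>(2) by (intro sum.cong) (auto simp: \<sigma>'_def)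
    ultimately show ?thesis unfolding restricted_QM_iff by blast
  qed
  ultimately show thesis using that by blast
qed

lemma stable: "stable_QM (QM fs)"
  unfolding stable_QM_def
proof (intro exI[of _ fs] conjI allI impI refl)
  fix U :: "'n rpoly set" assume "fin_dim_subspace U"
  then obtain A0 where A0: "finite A0" "U \<subseteq> supported A0"
    by (rule fin_dim_subspace_supportedE)
  obtain A where "finite A" "QM fs \<inter> supported A0 \<subseteq> restricted_QM (supported A) fs"
    using certificates_of_bounded_degree[OF A0(1)] by blast
  then show "\<exists>W. fin_dim_subspace W \<and> QM fs \<inter> U \<subseteq> restricted_QM W fs"
    using A0(2) by (intro exI[of _ "supported A"]) (auto simp: fin_dim_subspace_supported)
qed

text \<open>
  The empty combination is not strictly positive, so there is a first tentacle. On the interior of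
  \<open>K 1\<close>, which it contains, all generators are nonnegative, and at some point there none of the
  nonzero ones vanishes.
\<close>
lemma positive_point:
  obtains x0 where "\<And>h. h \<in> set (1 # fs) \<Longrightarrow> h \<noteq> 0 \<Longrightarrow> 0 < peval h x0"
proof -
  have "m \<ge> 1"
  proof (rule ccontr)
    assume "\<not> 1 \<le> m"
    with positive show False by (simp add: strictly_positive_def)
  qed
  then have 1: "1 \<in> {1..m}" by simp
  obtain x0 where x0: "x0 \<in> interior (K 1)" "\<forall>h\<in>{h \<in> set (1 # fs). h \<noteq> 0}. peval h x0 \<noteq> 0"
    using polys_nonzero_on_open[of "{h \<in> set (1 # fs). h \<noteq> 0}" "interior (K 1)"] interior[OF 1] by auto
  have x0K: "x0 \<in> tentacle (K 1) (z 1)"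
    using x0(1) interior_subset subset_tentacle by blast
  have "0 < peval h x0" if h: "h \<in> set (1 # fs)" "h \<noteq> 0" for h
  proof -
    have "0 \<le> peval h x0" using h(1) nonneg[OF 1 _ x0K] by auto
    moreover have "peval h x0 \<noteq> 0" using x0(2) h by blast
    ultimately show ?thesis by simp
  qed
  with that show thesis by blast
qed

lemma generators_positive_on_ball:
  "\<exists>x0 e \<delta>. 0 < e \<and> 0 < \<delta> \<and>
    (\<forall>i<Suc (length fs). gen i \<noteq> 0 \<longrightarrow> (\<forall>x\<in>ball x0 e. \<delta> \<le> peval (gen i) x))"
proof -
  obtain x0 where x0: "\<And>h. h \<in> set (1 # fs) \<Longrightarrow> h \<noteq> 0 \<Longrightarrow> 0 < peval h x0"
    using positive_point by blast
  let ?P = "{h \<in> set (1 # fs). h \<noteq> 0}"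
  have "\<exists>e>0. \<exists>\<delta>>0. \<forall>h\<in>?P. \<forall>x\<in>ball x0 e. \<delta> \<le> peval h x"
  proof (rule positive_on_ball)
    show "finite ?P" by simp
    show "0 < peval h x0" if "h \<in> ?P" for h using that x0 by blast
  qed
  then obtain e \<delta> where e: "e > 0" "\<delta> > 0" and \<delta>: "\<forall>h\<in>?P. \<forall>x\<in>ball x0 e. \<delta> \<le> peval h x"
    by (elim exE conjE) (rule that)
  have "\<delta> \<le> peval (gen i) x" if "i < Suc (length fs)" "gen i \<noteq> 0" "x \<in> ball x0 e" for i x
  proof -
    have "gen i \<in> set (1 # fs)" using that(1) by (intro nth_mem) simp
    then show ?thesis using \<delta> that(2,3) by blast
  qed
  with e show ?thesis by (intro exI[of _ x0] exI[of _ e] exI[of _ \<delta>]) simp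
qed

text \<open>
  By stability all the \<open>g k\<close> have certificates in one common finite dimensional space, so
  compactness applies on a ball where the nonzero generators are uniformly positive.
\<close>
lemma QM_coefficientwise_limit:
  assumes A0: "finite A0"
    and g: "\<And>k. g k \<in> QM fs" "\<And>k. g k \<in> supported A0"
    and lim: "\<And>\<alpha>. \<alpha> \<in> A0 \<Longrightarrow> (\<lambda>k. lookup (g k) \<alpha>) \<longlonglongrightarrow> lookup G \<alpha>"
    and G: "G \<in> supported A0"
  shows "G \<in> QM fs"
proof -
  obtain A where A: "finite A" "QM fs \<inter> supported A0 \<subseteq> restricted_QM (supported A) fs"
    using certificates_of_bounded_degree[OF A0(1)] by blast
  with g have "g k \<in> restricted_QM (supported A) fs" for k by blast
  then have "\<exists>b. \<forall>k. (\<forall>i<Suc (length fs). \<forall>\<alpha>\<in>A. b k i \<alpha> \<in> supported A) \<and>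
      g k = (\<Sum>i<Suc (length fs). (\<Sum>\<alpha>\<in>A. (b k i \<alpha>)\<^sup>2) * gen i)"
    unfolding restricted_QM_supported[OF A(1)] by (intro choice allI)
  then obtain b where b: "\<And>k i \<alpha>. i < Suc (length fs) \<Longrightarrow> \<alpha> \<in> A \<Longrightarrow> b k i \<alpha> \<in> supported A"
    and gb: "\<And>k. g k = (\<Sum>i<Suc (length fs). (\<Sum>\<alpha>\<in>A. (b k i \<alpha>)\<^sup>2) * gen i)"
    by blast
  define I where "I = {i. i < Suc (length fs) \<and> gen i \<noteq> 0}"
  have I: "finite I" by (simp add: I_def)
  have drop: "(\<Sum>i<Suc (length fs). c i * gen i) = (\<Sum>i\<in>I. c i * gen i)" for c
    by (rule sum.mono_neutral_right) (auto simp: I_def)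
  obtain x0 e \<delta> where e: "e > 0" "\<delta> > 0"
    and pos: "\<forall>i<Suc (length fs). gen i \<noteq> 0 \<longrightarrow> (\<forall>x\<in>ball x0 e. \<delta> \<le> peval (gen i) x)"
    using generators_positive_on_ball by (elim exE conjE) (rule that)
  have \<delta>: "\<delta> \<le> peval (gen i) x" if "i < Suc (length fs)" "gen i \<noteq> 0" "x \<in> ball x0 e" for i x
    using pos[rule_format, OF that] .
  have peval_G: "peval G x = (\<Sum>\<alpha>\<in>A0. lookup G \<alpha> * mon \<alpha> x)" for x
    using G A0 by (intro peval_alt) (auto simp: supported_def)
  have peval_g: "peval (g k) x = (\<Sum>\<alpha>\<in>A0. lookup (g k) \<alpha> * mon \<alpha> x)" for k x
    using g(2) A0 by (intro peval_alt) (auto simp: supported_def)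
  obtain C where C: "\<And>k x. x \<in> ball x0 e \<Longrightarrow> peval (g k) x \<le> C"
  proof -
    have "\<forall>\<alpha>\<in>A0. \<exists>c. \<forall>k. \<bar>lookup (g k) \<alpha>\<bar> \<le> c"
    proof
      fix \<alpha> assume "\<alpha> \<in> A0"
      with lim have "Bseq (\<lambda>k. lookup (g k) \<alpha>)" by (blast intro: convergent_imp_Bseq convergentI)
      then show "\<exists>c. \<forall>k. \<bar>lookup (g k) \<alpha>\<bar> \<le> c" by (auto simp: Bseq_def)
    qed
    from bchoice[OF this] obtain c where c: "\<And>\<alpha> k. \<alpha> \<in> A0 \<Longrightarrow> \<bar>lookup (g k) \<alpha>\<bar> \<le> c \<alpha>" by blast
    have "\<exists>d. \<forall>x\<in>ball x0 e. \<bar>mon \<alpha> x\<bar> \<le> d" for \<alpha> :: "nat ^ 'n"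
    proof -
      have "bounded (mon \<alpha> ` cball x0 e)"
        by (intro compact_imp_bounded compact_continuous_image continuous_on_mon compact_cball)
      then show ?thesis unfolding bounded_iff using ball_subset_cball[of x0 e] by fastforce
    qed
    then obtain d where d: "\<And>\<alpha> x. x \<in> ball x0 e \<Longrightarrow> \<bar>mon \<alpha> x\<bar> \<le> d \<alpha>" by metis
    have "peval (g k) x \<le> (\<Sum>\<alpha>\<in>A0. c \<alpha> * d \<alpha>)" if x: "x \<in> ball x0 e" for k x
      unfolding peval_g
    proof (rule sum_mono)
      fix \<alpha> assume \<alpha>: "\<alpha> \<in> A0"
      have "lookup (g k) \<alpha> * mon \<alpha> x \<le> \<bar>lookup (g k) \<alpha>\<bar> * \<bar>mon \<alpha> x\<bar>"
        by (metis abs_ge_self abs_mult)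
      also have "\<dots> \<le> c \<alpha> * d \<alpha>"
        using c[OF \<alpha>, of k] d[OF x, of \<alpha>] by (intro mult_mono) auto
      finally show "lookup (g k) \<alpha> * mon \<alpha> x \<le> c \<alpha> * d \<alpha>" .
    qed
    with that show thesis by blast
  qed
  have "\<exists>B. (\<forall>j\<in>I \<times> A. B j \<in> supported A) \<and>
      (\<forall>x. peval G x = (\<Sum>j\<in>I \<times> A. (peval (B j) x)\<^sup>2 * peval (gen (fst j)) x))"
  proof (rule weighted_squares_limit[where U = "ball x0 e" and \<delta> = \<delta> and C = C
        and b = "\<lambda>k (i, \<alpha>). b k i \<alpha>" and g = "\<lambda>k. peval (g k)" and h = "\<lambda>k j. peval (gen (fst j))"])
    show "peval (g k) x = (\<Sum>j\<in>I \<times> A. (peval ((\<lambda>(i, \<alpha>). b k i \<alpha>) j) x)\<^sup>2 * peval (gen (fst j)) x)" for k x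
      unfolding gb drop
      by (simp add: peval_sum peval_mult sum_distrib_right sum.cartesian_product case_prod_beta)
    show "(\<lambda>k. peval (g k) x) \<longlonglongrightarrow> peval G x" for x
      unfolding peval_g peval_G using lim by (intro tendsto_intros) auto
  qed (use A I e \<delta> C b in \<open>auto simp: I_def\<close>)
  then obtain B where B1: "\<forall>j\<in>I \<times> A. B j \<in> supported A"
    and B2: "\<forall>x. peval G x = (\<Sum>j\<in>I \<times> A. (peval (B j) x)\<^sup>2 * peval (gen (fst j)) x)"
    by (elim exE conjE) (rule that)
  define b' where "b' i \<alpha> = (if i \<in> I then B (i, \<alpha>) else 0)" for i \<alpha>
  have "peval G x = peval (\<Sum>i\<in>I. (\<Sum>\<alpha>\<in>A. (b' i \<alpha>)\<^sup>2) * gen i) x" for x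
  proof -
    have "peval G x = (\<Sum>i\<in>I. \<Sum>\<alpha>\<in>A. (peval (B (i, \<alpha>)) x)\<^sup>2 * peval (gen i) x)"
      unfolding B2[rule_format] sum.cartesian_product by (rule sum.cong) auto
    also have "\<dots> = peval (\<Sum>i\<in>I. (\<Sum>\<alpha>\<in>A. (b' i \<alpha>)\<^sup>2) * gen i) x"
      unfolding peval_sum peval_mult peval_power2 sum_distrib_right
      by (intro sum.cong refl) (simp only: b'_def if_True)
    finally show ?thesis .
  qed
  then have "G = (\<Sum>i\<in>I. (\<Sum>\<alpha>\<in>A. (b' i \<alpha>)\<^sup>2) * gen i)"
    by (rule peval_inject)
  then have "G = (\<Sum>i<Suc (length fs). (\<Sum>\<alpha>\<in>A. (b' i \<alpha>)\<^sup>2) * gen i)"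
    by (simp only: drop)
  moreover have "\<forall>i<Suc (length fs). \<forall>\<alpha>\<in>A. b' i \<alpha> \<in> supported A"
    using B1 by (auto simp: b'_def)
  ultimately have "G \<in> restricted_QM (supported A) fs"
    unfolding restricted_QM_supported[OF A(1)] by blast
  then show ?thesis using restricted_QM_subset_QM by blast
qed

end

section \<open>Separation from sets closed under coefficientwise limits\<close>

definition total_degree :: "nat ^ 'n::finite \<Rightarrow> nat"
  where "total_degree \<alpha> = (\<Sum>i\<in>UNIV. \<alpha> $ i)"

lemma finite_total_degree_less: "finite {\<alpha> :: nat ^ 'n::finite. total_degree \<alpha> < k}"
proof (rule finite_subset[OF _ finite_bounded_exponents])
  show "{\<alpha> :: nat ^ 'n. total_degree \<alpha> < k} \<subseteq> {\<alpha>. \<forall>i. \<alpha> $ i \<le> k}"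
  proof safe
    fix \<alpha> :: "nat ^ 'n" and i assume "total_degree \<alpha> < k"
    moreover have "\<alpha> $ i \<le> total_degree \<alpha>"
      unfolding total_degree_def by (rule member_le_sum) auto
    ultimately show "\<alpha> $ i \<le> k" by simp
  qed
qed

lemma seminorm_weighted_sum:
  assumes "\<And>\<alpha>. 0 \<le> w \<alpha>"
  shows "seminorm (\<lambda>p. \<Sum>\<alpha>\<in>keys p. \<bar>lookup p \<alpha>\<bar> * w \<alpha>)" (is "seminorm ?q")
proof -
  have alt: "?q p = (\<Sum>\<alpha>\<in>A. \<bar>lookup p \<alpha>\<bar> * w \<alpha>)" if "finite A" "keys p \<subseteq> A" for p A
    using that by (intro sum.mono_neutral_left) (auto simp: in_keys_iff)
  have "?q (p + q) \<le> ?q p + ?q q" for p q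
  proof -
    let ?A = "keys p \<union> keys q"
    have "?q (p + q) = (\<Sum>\<alpha>\<in>?A. \<bar>lookup p \<alpha> + lookup q \<alpha>\<bar> * w \<alpha>)"
      using keys_add[of p q] by (subst alt[of ?A]) (auto simp: lookup_add)
    also have "\<dots> \<le> (\<Sum>\<alpha>\<in>?A. \<bar>lookup p \<alpha>\<bar> * w \<alpha> + \<bar>lookup q \<alpha>\<bar> * w \<alpha>)"
      unfolding distrib_right[symmetric] using assms by (intro sum_mono mult_right_mono abs_triangle_ineq) auto
    also have "\<dots> = ?q p + ?q q"
      by (simp add: sum.distrib alt[of ?A])
    finally show ?thesis .
  qed
  moreover have "?q (c *\<^sub>R p) = \<bar>c\<bar> * ?q p" for c p
  proof -
    have "keys (c *\<^sub>R p) \<subseteq> keys p" by (auto simp: in_keys_iff)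
    then have "?q (c *\<^sub>R p) = (\<Sum>\<alpha>\<in>keys p. \<bar>c * lookup p \<alpha>\<bar> * w \<alpha>)"
      by (subst alt[of "keys p"]) auto
    then show ?thesis by (simp add: abs_mult sum_distrib_left mult.assoc)
  qed
  ultimately show ?thesis unfolding seminorm_def by blast
qed

text \<open>
  A separating seminorm is a weighted sum of the absolute values of the coefficients, with one
  weight for each total degree. The tolerances \<open>e i\<close> are chosen recursively so that the box around
  \<open>f\<close> with these side lengths in degrees below \<open>k\<close> avoids \<open>M\<close>. If no tolerance worked for degree
  \<open>k\<close>, points of \<open>M\<close> in boxes that get thin in degree \<open>k\<close> would accumulate at a point of the
  previous box, and that point would lie in \<open>M\<close>.
\<close>
lemma seminorm_separation:
  fixes M :: "('n::finite) rpoly set"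
  assumes limit: "\<And>A g G. finite A \<Longrightarrow> (\<And>k. g k \<in> M) \<Longrightarrow> (\<And>k. g k \<in> supported A) \<Longrightarrow>
      (\<And>\<alpha>. \<alpha> \<in> A \<Longrightarrow> (\<lambda>k. lookup (g k) \<alpha>) \<longlonglongrightarrow> lookup G \<alpha>) \<Longrightarrow> G \<in> supported A \<Longrightarrow> G \<in> M"
    and f: "f \<notin> M"
  shows "\<exists>q. seminorm q \<and> (\<forall>g\<in>M. 1 \<le> q (g - f))"
proof -
  define T where "T k = {\<alpha> :: nat ^ 'n. total_degree \<alpha> < k}" for k
  have finT: "finite (T k)" for k
    unfolding T_def by (rule finite_total_degree_less)
  define box where "box e k = {b \<in> supported (T k). \<forall>\<alpha>\<in>T k. \<bar>lookup b \<alpha>\<bar> \<le> e (total_degree \<alpha>)}"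
    for e :: "nat \<Rightarrow> real" and k
  define P where "P k e \<longleftrightarrow> (\<forall>i. 0 < e i) \<and> (\<forall>b\<in>box e k. f + b \<notin> M)" for k and e :: "nat \<Rightarrow> real"
  have "P 0 (\<lambda>_. 1)"
    using f by (auto simp: P_def box_def T_def supported_def)
  moreover have "\<exists>e'. P (Suc k) e' \<and> (\<forall>i<k. e' i = e i)" if P: "P k e" for k e
  proof (rule ccontr)
    assume contra: "\<not> ?thesis"
    have pos: "0 < e i" for i using P by (simp add: P_def)
    define d where "d n = e(k := 1 / real (Suc n))" for n
    have "\<not> P (Suc k) (d n)" for n
      using contra by (auto simp: d_def)
    moreover have "0 < d n i" for n i
      using pos by (simp add: d_def)
    ultimately have "\<exists>b. b \<in> box (d n) (Suc k) \<and> f + b \<in> M" for n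
      by (simp add: P_def Bex_def)
    then have "\<exists>b. \<forall>n. b n \<in> box (d n) (Suc k) \<and> f + b n \<in> M"
      by (intro choice allI)
    then obtain b where b: "\<And>n. b n \<in> box (d n) (Suc k)" "\<And>n. f + b n \<in> M" by blast
    have supp: "b n \<in> supported (T (Suc k))" for n
      using b(1)[of n] by (simp add: box_def)
    have le: "\<bar>lookup (b n) \<alpha>\<bar> \<le> d n (total_degree \<alpha>)" if "\<alpha> \<in> T (Suc k)" for n \<alpha>
      using b(1)[of n] that by (simp add: box_def)
    have bound: "\<bar>lookup (b n) \<alpha>\<bar> \<le> 1 + (\<Sum>i\<le>k. e i)" if "\<alpha> \<in> T (Suc k)" for n \<alpha>
    proof -
      have "d n (total_degree \<alpha>) \<le> 1 + e (total_degree \<alpha>)"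
        using pos[of k] pos[of "total_degree \<alpha>"] by (auto simp: d_def field_simps)
      also have "e (total_degree \<alpha>) \<le> (\<Sum>i\<le>k. e i)"
        using that pos by (intro member_le_sum) (auto simp: T_def less_imp_le)
      finally show ?thesis using le[OF that, of n] by simp
    qed
    obtain l r where r: "strict_mono (r :: nat \<Rightarrow> nat)"
      and l: "\<And>\<alpha>. \<alpha> \<in> T (Suc k) \<Longrightarrow> (\<lambda>n. lookup (b (r n)) \<alpha>) \<longlonglongrightarrow> l \<alpha>"
    proof (rule bounded_coordinates_subsequence[of "T (Suc k)" "\<lambda>n. lookup (b n)" "1 + (\<Sum>i\<le>k. e i)"])
      show "finite (T (Suc k))" by (rule finT)
      show "\<bar>lookup (b n) \<alpha>\<bar> \<le> 1 + (\<Sum>i\<le>k. e i)" if "\<alpha> \<in> T (Suc k)" for n \<alpha>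
        using bound[OF that] .
    qed blast
    have l_le: "\<bar>l \<alpha>\<bar> \<le> (if total_degree \<alpha> = k then 0 else e (total_degree \<alpha>))"
      if \<alpha>: "\<alpha> \<in> T (Suc k)" for \<alpha>
    proof (rule LIMSEQ_le)
      show "(\<lambda>n. \<bar>lookup (b (r n)) \<alpha>\<bar>) \<longlonglongrightarrow> \<bar>l \<alpha>\<bar>"
        by (intro tendsto_rabs l \<alpha>)
      show "(\<lambda>n. d (r n) (total_degree \<alpha>)) \<longlonglongrightarrow> (if total_degree \<alpha> = k then 0 else e (total_degree \<alpha>))"
        using LIMSEQ_subseq_LIMSEQ[OF lim_inverse_n'[THEN LIMSEQ_Suc] r]
        by (simp add: d_def comp_def)
      show "\<exists>N. \<forall>n\<ge>N. \<bar>lookup (b (r n)) \<alpha>\<bar> \<le> d (r n) (total_degree \<alpha>)"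
        using le[OF \<alpha>] by blast
    qed
    obtain B where B: "B \<in> supported (T (Suc k))" "\<And>\<alpha>. \<alpha> \<in> T (Suc k) \<Longrightarrow> lookup B \<alpha> = l \<alpha>"
      using supported_peval[OF finT, where c = l] by blast
    have "lookup B \<alpha> = 0" if "\<alpha> \<notin> T k" for \<alpha>
    proof (cases "\<alpha> \<in> T (Suc k)")
      case True
      with that have "total_degree \<alpha> = k" by (auto simp: T_def)
      with True l_le[of \<alpha>] B(2)[of \<alpha>] show ?thesis by simp
    next
      case False
      with B(1) show ?thesis by (auto simp: supported_def in_keys_iff)
    qed
    then have "B \<in> supported (T k)"
      by (auto simp: supported_def in_keys_iff)
    moreover have "\<bar>lookup B \<alpha>\<bar> \<le> e (total_degree \<alpha>)" if "\<alpha> \<in> T k" for \<alpha>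
    proof -
      from that have "\<alpha> \<in> T (Suc k)" "total_degree \<alpha> \<noteq> k" by (auto simp: T_def)
      with l_le[of \<alpha>] B(2)[of \<alpha>] show ?thesis by simp
    qed
    ultimately have "B \<in> box e k" by (simp add: box_def)
    moreover have "f + B \<in> M"
    proof (rule limit[of "keys f \<union> T (Suc k)" "\<lambda>n. f + b (r n)"])
      have sub: "supported (T (Suc k)) \<subseteq> supported (keys f \<union> T (Suc k))"
        by (auto simp: supported_def)
      have fs: "f \<in> supported (keys f \<union> T (Suc k))" by (auto simp: supported_def)
      show "f + b (r n) \<in> supported (keys f \<union> T (Suc k))" for n
        using supp[of "r n"] sub fs supported_add by blast
      show "f + B \<in> supported (keys f \<union> T (Suc k))"
        using B(1) sub fs supported_add by blast
      show "(\<lambda>n. lookup (f + b (r n)) \<alpha>) \<longlonglongrightarrow> lookup (f + B) \<alpha>" for \<alpha>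
      proof (cases "\<alpha> \<in> T (Suc k)")
        case True
        then show ?thesis
          unfolding lookup_add B(2)[OF True] by (intro tendsto_intros l)
      next
        case False
        then have "lookup (b (r n)) \<alpha> = 0" "lookup B \<alpha> = 0" for n
          using supp[of "r n"] B(1) by (auto simp: supported_def in_keys_iff)
        then show ?thesis by (simp add: lookup_add)
      qed
    qed (use b finT in auto)
    ultimately show False using P by (auto simp: P_def)
  qed
  ultimately obtain E where E: "\<And>k. P k (E k)" "\<And>k i. i < k \<Longrightarrow> E (Suc k) i = E k i"
    using dependent_nat_choice[of P "\<lambda>k e e'. \<forall>i<k. e' i = e i"] by blast
  define w where "w i = E (Suc i) i" for i
  have w: "E k i = w i" if "i < k" for k i
    using that
  proof (induction k)
    case (Suc k)
    then show ?case using E(2)[of i k] by (cases "i = k") (auto simp: w_def)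
  qed simp
  have w_pos: "0 < w i" for i using E(1)[of "Suc i"] by (simp add: P_def w_def)
  have avoid: "f + b \<notin> M" if "b \<in> box w k" for b k
  proof -
    have "b \<in> box (E k) k" using that w by (auto simp: box_def T_def)
    then show ?thesis using E(1)[of k] by (simp add: P_def)
  qed
  define q :: "'n rpoly \<Rightarrow> real"
    where "q p = (\<Sum>\<alpha>\<in>keys p. \<bar>lookup p \<alpha>\<bar> * inverse (w (total_degree \<alpha>)))" for p
  have "seminorm q"
    unfolding q_def[abs_def] using w_pos by (intro seminorm_weighted_sum) (simp add: less_imp_le)
  moreover have "1 \<le> q (g - f)" if g: "g \<in> M" for g
  proof (rule ccontr)
    assume q: "\<not> 1 \<le> q (g - f)"
    define b where "b = g - f"
    have le: "\<bar>lookup b \<alpha>\<bar> \<le> w (total_degree \<alpha>)" for \<alpha>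
    proof (cases "\<alpha> \<in> keys b")
      case True
      then have "\<bar>lookup b \<alpha>\<bar> * inverse (w (total_degree \<alpha>)) \<le> q b"
        unfolding q_def using w_pos by (intro member_le_sum) (auto simp: less_imp_le)
      with q have "\<bar>lookup b \<alpha>\<bar> * inverse (w (total_degree \<alpha>)) \<le> 1" by (simp add: b_def)
      then show ?thesis using w_pos[of "total_degree \<alpha>"] by (simp add: field_simps)
    next
      case False
      then show ?thesis using w_pos[of "total_degree \<alpha>"] by (simp add: in_keys_iff)
    qed
    obtain k where "\<forall>\<alpha>\<in>keys b. total_degree \<alpha> < k"
      using finite_nat_set_iff_bounded[of "total_degree ` keys b"] by auto
    then have "b \<in> box w k" using le by (auto simp: box_def supported_def T_def)
    from avoid[OF this] g show False by (simp add: b_def)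
  qed
  ultimately show ?thesis by blast
qed

lemma closedin_finest_lc_topology:
  fixes M :: "('a::real_vector) set"
  assumes "\<And>f. f \<notin> M \<Longrightarrow> \<exists>q. seminorm q \<and> (\<forall>g\<in>M. 1 \<le> q (g - f))"
  shows "closedin finest_lc_topology M"
proof -
  let ?S = "{{y. q (y - x) < e} | q (x::'a) e. seminorm q \<and> 0 < e}"
  have "seminorm (\<lambda>_::'a. 0)" by (simp add: seminorm_def)
  then have "UNIV \<in> ?S" by (intro CollectI exI[of _ "\<lambda>_. 0"] exI[of _ 0] exI[of _ 1]) auto
  then have "\<Union> ?S = UNIV" by (rule antisym[OF subset_UNIV Union_upper])
  then have top: "topspace (finest_lc_topology :: 'a topology) = UNIV"
    by (simp only: finest_lc_topology_def topology_generated_by_topspace)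
  have "\<exists>V. openin finest_lc_topology V \<and> f \<in> V \<and> V \<subseteq> - M" if f: "f \<in> - M" for f
  proof -
    obtain q where q: "seminorm q" "\<forall>g\<in>M. 1 \<le> q (g - f)" using assms f by blast
    have "q 0 = 0" using q(1) unfolding seminorm_def by (metis abs_zero mult_zero_left scaleR_zero_left)
    moreover have "{y. q (y - f) < 1} \<in> ?S"
      using q(1) by (intro CollectI exI[of _ q] exI[of _ f] exI[of _ 1]) auto
    then have "openin finest_lc_topology {y. q (y - f) < 1}"
      unfolding finest_lc_topology_def by (rule topology_generated_by_Basis)
    moreover have "{y. q (y - f) < 1} \<subseteq> - M" using q(2) by force
    ultimately show ?thesis by (intro exI[of _ "{y. q (y - f) < 1}"]) simp
  qed
  then have "openin finest_lc_topology (- M)"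
    by (subst openin_subopen) blast
  then show ?thesis
    unfolding closedin_def top by (simp add: Compl_eq_Diff_UNIV)
qed

section \<open>Linear functionals below a sublinear one\<close>

definition sublinear :: "('a::real_vector \<Rightarrow> real) \<Rightarrow> bool"
  where "sublinear p \<longleftrightarrow> (\<forall>x y. p (x + y) \<le> p x + p y) \<and> (\<forall>c>0. \<forall>x. p (c *\<^sub>R x) \<le> c * p x)"

lemma sublinear_add: "sublinear p \<Longrightarrow> p (x + y) \<le> p x + p y"
  by (simp add: sublinear_def)

lemma sublinear_scale:
  assumes "sublinear p" "c > 0"
  shows "p (c *\<^sub>R x) = c * p x"
proof (rule antisym)
  show "p (c *\<^sub>R x) \<le> c * p x" using assms by (simp add: sublinear_def)
  have "p (inverse c *\<^sub>R (c *\<^sub>R x)) \<le> inverse c * p (c *\<^sub>R x)"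
    using assms unfolding sublinear_def by (metis inverse_positive_iff_positive)
  then show "c * p x \<le> p (c *\<^sub>R x)" using assms(2) by (simp add: field_simps)
qed

lemma sublinear_0: "sublinear p \<Longrightarrow> p 0 = 0"
  using sublinear_scale[of p 2 0] by simp

lemma sublinear_uminus: "sublinear p \<Longrightarrow> - p (- x) \<le> p x"
  using sublinear_add[of p x "- x"] sublinear_0[of p] by simp

lemma sublinear_Inf:
  fixes F :: "'i \<Rightarrow> ('a::real_vector) \<Rightarrow> real"
  assumes "I \<noteq> {}"
    and bdd: "\<And>x. \<exists>B. \<forall>i\<in>I. B \<le> F i x"
    and add: "\<And>i j x y. i \<in> I \<Longrightarrow> j \<in> I \<Longrightarrow> \<exists>k\<in>I. F k (x + y) \<le> F i x + F j y"
    and scale: "\<And>i c x. i \<in> I \<Longrightarrow> 0 < c \<Longrightarrow> \<exists>k\<in>I. F k (c *\<^sub>R x) \<le> c * F i x"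
  shows "sublinear (\<lambda>x. INF i\<in>I. F i x)"
proof -
  have lower: "(INF i\<in>I. F i x) \<le> F k x" if "k \<in> I" for k x
    using bdd[of x] that by (intro cINF_lower) (auto simp: bdd_below_def)
  have "(INF i\<in>I. F i (x + y)) \<le> (INF i\<in>I. F i x) + (INF i\<in>I. F i y)" for x y
  proof -
    have step: "(INF i\<in>I. F i (x + y)) \<le> F i x + F j y" if "i \<in> I" "j \<in> I" for i j
      using add[OF that, of x y] lower order_trans by blast
    have "(INF i\<in>I. F i (x + y)) - F j y \<le> (INF i\<in>I. F i x)" if "j \<in> I" for j
      using assms(1) step that by (intro cINF_greatest) (auto simp: algebra_simps)
    then have "(INF i\<in>I. F i (x + y)) - (INF i\<in>I. F i x) \<le> (INF i\<in>I. F i y)"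
      using assms(1) by (intro cINF_greatest) (auto simp: algebra_simps)
    then show ?thesis by simp
  qed
  moreover have "(INF i\<in>I. F i (c *\<^sub>R x)) \<le> c * (INF i\<in>I. F i x)" if c: "0 < c" for c x
  proof -
    have "(INF i\<in>I. F i (c *\<^sub>R x)) / c \<le> (INF i\<in>I. F i x)"
    proof (rule cINF_greatest[OF assms(1)])
      fix i assume "i \<in> I"
      with scale[OF this c, of x] lower have "(INF i\<in>I. F i (c *\<^sub>R x)) \<le> c * F i x"
        using order_trans by blast
      then show "(INF i\<in>I. F i (c *\<^sub>R x)) / c \<le> F i x"
        using c by (simp add: field_simps)
    qed
    then show ?thesis using c by (simp add: field_simps)
  qed
  ultimately show ?thesis unfolding sublinear_def by blast
qed

text \<open>
  Lowers a sublinear function \<open>p\<close> so that it respects linear constraints collected in a convex cone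
  \<open>N\<close> of pairs of a vector and a value. The infimum of \<open>p (x + n) - s\<close> over \<open>(n, s)\<close> in \<open>N\<close> does it;
  it is finite because the constraints are compatible with \<open>p\<close>. It is used with a ray, to make a minimal
  sublinear function linear, and with a convex cone, to separate it from a point.
\<close>
lemma sublinear_lowering:
  fixes p :: "('a::real_vector) \<Rightarrow> real" and N :: "('a \<times> real) set"
  assumes p: "sublinear p"
    and zero: "(0, 0) \<in> N"
    and add: "\<And>n s n' s'. (n, s) \<in> N \<Longrightarrow> (n', s') \<in> N \<Longrightarrow> (n + n', s + s') \<in> N"
    and scale: "\<And>n s c. (n, s) \<in> N \<Longrightarrow> 0 < c \<Longrightarrow> (c *\<^sub>R n, c * s) \<in> N"
    and le: "\<And>n s. (n, s) \<in> N \<Longrightarrow> s \<le> p n"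
  shows "\<exists>p'. sublinear p' \<and> p' \<le> p \<and> (\<forall>(n, s)\<in>N. p' (- n) \<le> - s)"
proof -
  let ?F = "\<lambda>(n, s) x. p (x + n) - s"
  let ?p = "\<lambda>x. INF i\<in>N. ?F i x"
  have low: "- p (- x) \<le> ?F i x" if "i \<in> N" for i x
  proof -
    obtain n s where i: "i = (n, s)" by fastforce
    have "p ((x + n) + - x) \<le> p (x + n) + p (- x)" by (rule sublinear_add[OF p])
    with le[of n s] that show ?thesis by (simp add: i)
  qed
  have lower: "?p x \<le> ?F i x" if "i \<in> N" for i x
    using low that by (intro cINF_lower bdd_belowI2[of _ "- p (- x)"])
  have "sublinear ?p"
  proof (rule sublinear_Inf)
    show "N \<noteq> {}" using zero by blast
    show "\<exists>B. \<forall>i\<in>N. B \<le> ?F i x" for x using low by blast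
    show "\<exists>k\<in>N. ?F k (x + y) \<le> ?F i x + ?F j y" if "i \<in> N" "j \<in> N" for i j x y
    proof -
      obtain n s n' s' where ij: "i = (n, s)" "j = (n', s')" by fastforce
      have "p ((x + n) + (y + n')) \<le> p (x + n) + p (y + n')" by (rule sublinear_add[OF p])
      moreover have "(x + n) + (y + n') = x + y + (n + n')" by simp
      ultimately show ?thesis
        using add[of n s n' s'] that by (intro bexI[of _ "(n + n', s + s')"]) (auto simp: ij)
    qed
    show "\<exists>k\<in>N. ?F k (c *\<^sub>R x) \<le> c * ?F i x" if "i \<in> N" "0 < c" for i c x
    proof -
      obtain n s where i: "i = (n, s)" by fastforce
      have "p (c *\<^sub>R (x + n)) = c * p (x + n)" by (rule sublinear_scale[OF p that(2)])
      then show ?thesis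
        using scale[of n s c] that
        by (intro bexI[of _ "(c *\<^sub>R n, c * s)"]) (auto simp: i algebra_simps)
    qed
  qed
  moreover have "?p \<le> p"
    using lower[OF zero] by (auto simp: le_fun_def)
  moreover have "?p (- n) \<le> - s" if "(n, s) \<in> N" for n s
    using lower[OF that, of "- n"] sublinear_0[OF p] by simp
  ultimately show ?thesis by (intro exI[of _ ?p]) auto
qed

text \<open>
  The Hahn-Banach theorem. A minimal sublinear function \<open>L\<close> below \<open>p\<close> exists by Zorn's lemma. It is
  linear: lowering it along the ray through \<open>v\<close> gives a sublinear function with value at most
  \<open>- L v\<close> at \<open>- v\<close>, and by minimality this function is \<open>L\<close> itself.
\<close>
lemma linear_below_sublinear:
  fixes p :: "('a::real_vector) \<Rightarrow> real"
  assumes p: "sublinear p"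
  shows "\<exists>L. linear L \<and> L \<le> p"
proof -
  let ?A = "{q. sublinear q \<and> q \<le> p}"
  let ?P = "\<lambda>q q' :: 'a \<Rightarrow> real. q' \<le> q"
  have "\<exists>m\<in>?A. \<forall>q\<in>?A. ?P m q \<longrightarrow> q = m"
  proof (rule predicate_Zorn)
    show "partial_order_on ?A (relation_of ?P ?A)"
      unfolding partial_order_on_def preorder_on_def refl_on_def trans_def antisym_def relation_of_def
      by (auto intro: order_trans)
    fix C assume "C \<in> Chains (relation_of ?P ?A)"
    then have C: "C \<subseteq> ?A" and chain: "\<And>a b. a \<in> C \<Longrightarrow> b \<in> C \<Longrightarrow> a \<le> b \<or> b \<le> a"
      unfolding Chains_def relation_of_def by blast+
    show "\<exists>u\<in>?A. \<forall>a\<in>C. ?P a u"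
    proof (cases "C = {}")
      case True
      then show ?thesis using p by auto
    next
      case False
      let ?u = "\<lambda>x. INF a\<in>C. a x"
      have low: "- p (- x) \<le> a x" if "a \<in> C" for a x
      proof -
        have "sublinear a" "a (- x) \<le> p (- x)" using that C by (auto simp: le_fun_def)
        then show ?thesis using sublinear_uminus[of a x] by simp
      qed
      have lower: "?u x \<le> a x" if "a \<in> C" for a x
        using low that by (intro cINF_lower bdd_belowI2[of _ "- p (- x)"])
      have "sublinear ?u"
      proof (rule sublinear_Inf[OF False])
        show "\<exists>B. \<forall>a\<in>C. B \<le> a x" for x using low by blast
        show "\<exists>c\<in>C. c (x + y) \<le> a x + b y" if ab: "a \<in> C" "b \<in> C" for a b x y
        proof -
          obtain c where c: "c \<in> C" "c \<le> a" "c \<le> b" using chain[OF ab] ab by blast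
          then have "c (x + y) \<le> c x + c y" using C sublinear_add by blast
          also have "\<dots> \<le> a x + b y" using c by (intro add_mono) (auto simp: le_fun_def)
          finally show ?thesis using c(1) by blast
        qed
        show "\<exists>b\<in>C. b (c *\<^sub>R x) \<le> c * a x" if "a \<in> C" "0 < c" for a c x
        proof -
          have "sublinear a" using that(1) C by blast
          then show ?thesis using that sublinear_scale[of a c x] by (intro bexI[of _ a]) simp_all
        qed
      qed
      moreover obtain a where "a \<in> C" using False by blast
      then have "?u \<le> p"
        using lower C unfolding le_fun_def by (metis (mono_tags, lifting) in_mono le_funD mem_Collect_eq order_trans)
      ultimately show ?thesis
        using lower by (intro bexI[of _ ?u]) (auto simp: le_fun_def)
    qed
  qed
  then obtain L where L: "sublinear L" "L \<le> p"
    and min: "\<And>q. sublinear q \<Longrightarrow> q \<le> L \<Longrightarrow> q = L"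
    by (auto intro: order_trans)
  have neg: "L (- v) = - L v" for v
  proof -
    let ?N = "(\<lambda>t. (t *\<^sub>R v, t * L v)) ` {0..}"
    have "\<exists>p'. sublinear p' \<and> p' \<le> L \<and> (\<forall>(n, s)\<in>?N. p' (- n) \<le> - s)"
    proof (rule sublinear_lowering[OF L(1)])
      show "(n + n', s + s') \<in> ?N" if ns: "(n, s) \<in> ?N" "(n', s') \<in> ?N" for n s n' s'
      proof -
        obtain t t' where "t \<ge> 0" "t' \<ge> 0" "n = t *\<^sub>R v" "s = t * L v" "n' = t' *\<^sub>R v" "s' = t' * L v"
          using ns by auto
        then show ?thesis by (intro image_eqI[of _ _ "t + t'"]) (auto simp: algebra_simps)
      qed
      show "(c *\<^sub>R n, c * s) \<in> ?N" if ns: "(n, s) \<in> ?N" "0 < c" for n s c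
      proof -
        obtain t where "t \<ge> 0" "n = t *\<^sub>R v" "s = t * L v"
          using ns by auto
        then show ?thesis using ns(2) by (intro image_eqI[of _ _ "c * t"]) auto
      qed
      show "s \<le> L n" if ns: "(n, s) \<in> ?N" for n s
      proof -
        obtain t where t: "t \<ge> 0" "n = t *\<^sub>R v" "s = t * L v"
          using ns by auto
        then show ?thesis
          using sublinear_scale[OF L(1), of t v] sublinear_0[OF L(1)] by (cases "t = 0") auto
      qed
    qed auto
    then obtain p' where p': "sublinear p'" "p' \<le> L" "\<forall>(n, s)\<in>?N. p' (- n) \<le> - s" by blast
    have "(v, L v) \<in> ?N" by (rule image_eqI[of _ _ 1]) auto
    with p' have "p' (- v) \<le> - L v" by blast
    with min[OF p'(1,2)] sublinear_uminus[OF L(1), of "v"] show ?thesis by simp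
  qed
  have "linear L"
  proof (rule linearI)
    show "L (x + y) = L x + L y" for x y
      using sublinear_add[OF L(1), of x y] sublinear_add[OF L(1), of "- x" "- y"] neg[of x] neg[of y]
        neg[of "x + y"] by simp
    show "L (c *\<^sub>R x) = c *\<^sub>R L x" for c x
    proof (cases c "0::real" rule: linorder_cases)
      case less
      then have "L ((- c) *\<^sub>R x) = - c * L x" by (intro sublinear_scale[OF L(1)]) simp
      with neg[of "c *\<^sub>R x"] show ?thesis by simp
    next
      case equal
      then show ?thesis by (simp add: sublinear_0[OF L(1)])
    next
      case greater
      then show ?thesis by (simp add: sublinear_scale[OF L(1)])
    qed
  qed
  with L(2) show ?thesis by blast
qed

text \<open>
  Below \<open>q\<close> there is a sublinear function that is nonpositive on \<open>M\<close> and at most \<open>-1\<close> at \<open>- f\<close>. The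
  two kinds of constraint are compatible because \<open>q (t f - g) = t q (g / t - f) \<ge> t\<close> for \<open>g\<close> in the
  cone \<open>M\<close> and \<open>t > 0\<close>.
\<close>
lemma separating_functional:
  fixes M :: "('a::real_vector) set"
  assumes q: "seminorm q" "\<And>g. g \<in> M \<Longrightarrow> 1 \<le> q (g - f)"
    and M: "0 \<in> M" "\<And>g h. g \<in> M \<Longrightarrow> h \<in> M \<Longrightarrow> g + h \<in> M" "\<And>c g. 0 < c \<Longrightarrow> g \<in> M \<Longrightarrow> c *\<^sub>R g \<in> M"
  shows "\<exists>L :: 'a \<Rightarrow> real. linear L \<and> (\<forall>g\<in>M. 0 \<le> L g) \<and> L f < 0"
proof -
  have q_scale: "q (c *\<^sub>R x) = \<bar>c\<bar> * q x" and q_add: "q (x + y) \<le> q x + q y" for c x y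
    using q(1) by (simp_all add: seminorm_def)
  have q_nonneg: "0 \<le> q x" for x
    using q_add[of x "- x"] q_scale[of "- 1" x] q_scale[of 0 x] by simp
  have sub: "sublinear q"
    using q_add q_scale by (simp add: sublinear_def)
  let ?N = "(\<lambda>(t, g). (t *\<^sub>R f - g, t)) ` ({0..} \<times> M)"
  have "\<exists>p'. sublinear p' \<and> p' \<le> q \<and> (\<forall>(n, s)\<in>?N. p' (- n) \<le> - s)"
  proof (rule sublinear_lowering[OF sub])
    show "(0, 0) \<in> ?N" using M(1) by (intro image_eqI[of _ _ "(0, 0)"]) auto
    show "(n + n', s + s') \<in> ?N" if ns: "(n, s) \<in> ?N" "(n', s') \<in> ?N" for n s n' s'
    proof -
      obtain g g' where "0 \<le> s" "0 \<le> s'" "g \<in> M" "g' \<in> M" "n = s *\<^sub>R f - g" "n' = s' *\<^sub>R f - g'"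
        using ns by auto
      then show ?thesis
        using M(2) by (intro image_eqI[of _ _ "(s + s', g + g')"]) (auto simp: algebra_simps)
    qed
    show "(c *\<^sub>R n, c * s) \<in> ?N" if ns: "(n, s) \<in> ?N" "0 < c" for n s c
    proof -
      obtain g where "0 \<le> s" "g \<in> M" "n = s *\<^sub>R f - g" using ns by auto
      then show ?thesis
        using M(3) ns(2) by (intro image_eqI[of _ _ "(c * s, c *\<^sub>R g)"]) (auto simp: scaleR_diff_right)
    qed
    show "s \<le> q n" if ns: "(n, s) \<in> ?N" for n s
    proof -
      obtain g where s: "0 \<le> s" "g \<in> M" "n = s *\<^sub>R f - g" using ns by auto
      show ?thesis
      proof (cases "s = 0")
        case True
        then show ?thesis by (simp add: q_nonneg)
      next
        case False
        with s have "s > 0" by simp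
        have "n = (- s) *\<^sub>R (inverse s *\<^sub>R g - f)"
          using \<open>s > 0\<close> by (simp add: s(3) algebra_simps)
        then have "q n = s * q (inverse s *\<^sub>R g - f)"
          using q_scale[of "- s" "inverse s *\<^sub>R g - f"] \<open>s > 0\<close> by simp
        moreover have "1 \<le> q (inverse s *\<^sub>R g - f)"
          using \<open>s > 0\<close> s(2) by (intro q(2) M(3)) auto
        ultimately show ?thesis using \<open>s > 0\<close> by simp
      qed
    qed
  qed
  then obtain p' where p': "sublinear p'" "\<forall>(n, s)\<in>?N. p' (- n) \<le> - s" by blast
  obtain L where L: "linear L" "L \<le> p'" using linear_below_sublinear[OF p'(1)] by blast
  have "L g \<le> 0" if "g \<in> M" for g
  proof -
    have "(- g, 0) \<in> ?N" using that by (intro image_eqI[of _ _ "(0, g)"]) auto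
    with p'(2) have "p' g \<le> 0" by force
    then show ?thesis using L(2) by (meson le_funD order_trans)
  qed
  moreover have "(f, 1) \<in> ?N" using M(1) by (intro image_eqI[of _ _ "(1, 0)"]) auto
  with p'(2) have "p' (- f) \<le> - 1" by blast
  then have "L (- f) \<le> - 1" using L(2) by (meson le_funD order_trans)
  then have "L f \<ge> 1" using linear_neg[OF L(1), of f] by simp
  moreover have "linear (\<lambda>x. - L x)"
    using L(1) by (rule linear_compose_neg)
  ultimately have "linear (\<lambda>x. - L x) \<and> (\<forall>g\<in>M. 0 \<le> - L g) \<and> - L f < 0"
    by auto
  then show ?thesis by blast
qed

section \<open>Affine substitutions\<close>

definition degree_le :: "nat \<Rightarrow> (nat ^ 'n::finite) set"
  where "degree_le d = {\<alpha>. total_degree \<alpha> \<le> d}"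

lemma finite_degree_le: "finite (degree_le d)"
  using finite_total_degree_less[of "Suc d"] by (simp add: degree_le_def less_Suc_eq_le)

lemma total_degree_add: "total_degree (\<alpha> + \<beta>) = total_degree \<alpha> + total_degree \<beta>"
  by (simp add: total_degree_def sum.distrib)

lemma supported_mono: "A \<subseteq> B \<Longrightarrow> p \<in> supported A \<Longrightarrow> p \<in> supported B"
  by (auto simp: supported_def)

lemma degree_le_mono: "d \<le> e \<Longrightarrow> degree_le d \<subseteq> degree_le e"
  by (auto simp: degree_le_def)

lemma supported_degree_mult:
  assumes "p \<in> supported (degree_le d)" "q \<in> supported (degree_le e)"
  shows "p * q \<in> supported (degree_le (d + e))"
  using keys_mult[of p q] assms
  by (fastforce simp: supported_def degree_le_def total_degree_add intro: add_mono)

lemma supported_degree_one: "1 \<in> supported (degree_le 0)"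
  by (simp add: supported_def degree_le_def total_degree_def)

lemma supported_degree_power:
  assumes "p \<in> supported (degree_le 1)"
  shows "p ^ k \<in> supported (degree_le k)"
proof (induction k)
  case (Suc k)
  with supported_degree_mult[OF assms Suc] show ?case by simp
qed (simp add: supported_degree_one)

lemma peval_power: "peval (p ^ k) x = peval p x ^ k"
  by (induction k) (auto simp: peval_mult)

lemma mon_axis: "mon (axis i 1) x = x $ i"
proof -
  have "(x $ j) ^ (axis i 1 $ j) = (if j = i then x $ i else 1)" for j
    by (simp add: axis_def)
  then show ?thesis by (simp add: mon_def)
qed

lemma affine_substitution:
  fixes p :: "('n::finite) rpoly"
  assumes p: "p \<in> supported (degree_le d)"
  shows "\<exists>p'. p' \<in> supported (degree_le d) \<and> (\<forall>x. peval p' x = peval p (x0 + c *\<^sub>R x))"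
proof -
  define l :: "'n \<Rightarrow> 'n rpoly" where "l i = single 0 (x0 $ i) + single (axis i 1) c" for i
  have "single 0 (x0 $ i) \<in> supported (degree_le 1)" "single (axis i 1) c \<in> supported (degree_le 1)" for i
    by (auto simp: supported_def degree_le_def total_degree_def axis_def)
  then have l: "l i \<in> supported (degree_le 1)" for i
    unfolding l_def by (intro supported_add)
  have peval_l: "peval (l i) x = x0 $ i + c * x $ i" for i x
    by (simp only: l_def peval_add peval_single mon_0 mon_axis mult_1_right)
  have prod: "(\<Prod>i\<in>I. l i ^ k i) \<in> supported (degree_le (\<Sum>i\<in>I. k i))
      \<and> (\<forall>x. peval (\<Prod>i\<in>I. l i ^ k i) x = (\<Prod>i\<in>I. (x0 $ i + c * x $ i) ^ k i))"
    if "finite I" for I and k :: "'n \<Rightarrow> nat"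
    using that
  proof (induction I rule: finite_induct)
    case (insert i I)
    have "l i ^ k i * (\<Prod>i\<in>I. l i ^ k i) \<in> supported (degree_le (k i + (\<Sum>i\<in>I. k i)))"
      using insert.IH by (intro supported_degree_mult supported_degree_power l) auto
    with insert show ?case by (simp add: peval_mult peval_power peval_l)
  qed (simp add: supported_degree_one)
  define p' where "p' = (\<Sum>\<alpha>\<in>keys p. single 0 (lookup p \<alpha>) * (\<Prod>i\<in>UNIV. l i ^ (\<alpha> $ i)))"
  have "p' \<in> supported (degree_le d)"
    unfolding p'_def
  proof (intro supported_sum supported_const_mult)
    fix \<alpha> assume "\<alpha> \<in> keys p"
    then have "total_degree \<alpha> \<le> d" using p by (auto simp: supported_def degree_le_def)
    then have sub: "degree_le (\<Sum>i\<in>UNIV. \<alpha> $ i) \<subseteq> (degree_le d :: (nat ^ 'n) set)"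
      unfolding total_degree_def by (rule degree_le_mono)
    show "(\<Prod>i\<in>UNIV. l i ^ (\<alpha> $ i)) \<in> supported (degree_le d)"
      using prod[of UNIV "\<lambda>i. \<alpha> $ i"] by (intro supported_mono[OF sub]) simp
  qed
  moreover have "peval p' x = peval p (x0 + c *\<^sub>R x)" for x
    unfolding p'_def peval_sum peval_mult peval_keys[of p] mon_def
    using prod[OF finite, of "\<lambda>i. _ $ i"] by (intro sum.cong refl) simp
  ultimately show ?thesis by blast
qed

section \<open>A nonnegative polynomial that is not a sum of squares\<close>

text \<open>
  Serves both as an exponent of a monomial in two variables and as a point or a direction in a
  coordinate plane.
\<close>
definition pair_vec :: "'n::finite \<Rightarrow> 'n \<Rightarrow> 'a::zero \<Rightarrow> 'a \<Rightarrow> 'a ^ 'n"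
  where "pair_vec i j s t = (\<chi> k. if k = i then s else if k = j then t else 0)"

lemma pair_vec_inject:
  "i \<noteq> j \<Longrightarrow> pair_vec i j s t = pair_vec i j s' t' \<longleftrightarrow> s = s' \<and> t = t'"
  by (auto simp: pair_vec_def vec_eq_iff split: if_splits)

lemma pair_vec_nth: "pair_vec i j s t $ i = s" "i \<noteq> j \<Longrightarrow> pair_vec i j s t $ j = t"
  by (simp_all add: pair_vec_def)

lemma mon_pair_vec:
  assumes "i \<noteq> j"
  shows "mon (pair_vec i j a b) x = (x $ i) ^ a * (x $ j) ^ b"
proof -
  have "mon (pair_vec i j a b) x = (\<Prod>k\<in>{i, j}. (x $ k) ^ (pair_vec i j a b $ k))"
    unfolding mon_def by (rule prod.mono_neutral_right) (auto simp: pair_vec_def)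
  with assms show ?thesis by (simp add: pair_vec_def)
qed

lemma wdeg_pair_vec:
  assumes "i \<noteq> j"
  shows "wdeg (pair_vec i j s t) \<alpha> = s * int (\<alpha> $ i) + t * int (\<alpha> $ j)"
proof -
  have "wdeg (pair_vec i j s t) \<alpha> = (\<Sum>k\<in>{i, j}. pair_vec i j s t $ k * int (\<alpha> $ k))"
    unfolding wdeg_def by (rule sum.mono_neutral_right) (auto simp: pair_vec_def)
  with assms show ?thesis by (simp add: pair_vec_def)
qed

text \<open>
  With \<open>x\<close> and \<open>y\<close> the variables \<open>i\<close> and \<open>j\<close>, this is the polynomial \<open>x\<^sup>2y\<^sup>2(x\<^sup>2 + y\<^sup>2 - 1) + 1\<close> of
  Berg, Christensen and Jensen, a relative of Motzkin's polynomial.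
\<close>
definition berg :: "'n::finite \<Rightarrow> 'n \<Rightarrow> 'n rpoly"
  where "berg i j = single (pair_vec i j 4 2) 1 + single (pair_vec i j 2 4) 1
    - single (pair_vec i j 2 2) 1 + single (pair_vec i j 0 0) 1"

lemma keys_berg:
  "keys (berg i j) \<subseteq> {pair_vec i j 4 2, pair_vec i j 2 4, pair_vec i j 2 2, pair_vec i j 0 0}"
proof -
  have "berg i j \<in> supported {pair_vec i j 4 2, pair_vec i j 2 4, pair_vec i j 2 2, pair_vec i j 0 0}"
    unfolding berg_def by (intro supported_add supported_diff) (auto simp: supported_def)
  then show ?thesis by (simp add: supported_def)
qed

lemma peval_berg:
  assumes "i \<noteq> j"
  shows "peval (berg i j) x = (x $ i) ^ 4 * (x $ j)\<^sup>2 + (x $ i)\<^sup>2 * (x $ j) ^ 4 - (x $ i)\<^sup>2 * (x $ j)\<^sup>2 + 1"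
  by (simp add: berg_def peval_add peval_diff mon_pair_vec[OF assms])

text \<open>
  Only where \<open>x\<^sup>2 + y\<^sup>2 < 1\<close> can the first summand be negative, and there its absolute value is at
  most \<open>1\<close>.
\<close>
lemma berg_nonneg:
  assumes "i \<noteq> j"
  shows "0 \<le> peval (berg i j) x"
proof -
  define s t where "s = (x $ i)\<^sup>2" and "t = (x $ j)\<^sup>2"
  have nonneg: "0 \<le> s" "0 \<le> t" by (simp_all add: s_def t_def)
  have eq: "peval (berg i j) x = s * t * (s + t - 1) + 1"
    unfolding peval_berg[OF assms] s_def t_def by (simp add: algebra_simps flip: power_add power_mult)
  show ?thesis
  proof (cases "s + t \<ge> 1")
    case True
    then show ?thesis unfolding eq using nonneg by (intro add_nonneg_nonneg mult_nonneg_nonneg) auto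
  next
    case False
    have "s * t * (1 - (s + t)) \<le> 1 * 1 * 1"
      using False nonneg by (intro mult_mono mult_nonneg_nonneg) auto
    then show ?thesis unfolding eq by (simp add: algebra_simps)
  qed
qed

lemma berg_degree: "i \<noteq> j \<Longrightarrow> berg i j \<in> supported (degree_le 6)"
proof -
  assume ij: "i \<noteq> j"
  have "total_degree (pair_vec i j a b) = a + b" for a b
  proof -
    have "total_degree (pair_vec i j a b) = (\<Sum>k\<in>{i, j}. pair_vec i j a b $ k)"
      unfolding total_degree_def by (rule sum.mono_neutral_right) (auto simp: pair_vec_def)
    with ij show ?thesis by (simp add: pair_vec_def)
  qed
  then have "{pair_vec i j 4 2, pair_vec i j 2 4, pair_vec i j 2 2, pair_vec i j 0 0} \<subseteq> degree_le 6"
    by (simp add: degree_le_def)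
  with keys_berg[of i j] show ?thesis by (auto simp: supported_def)
qed

text \<open>
  The degree bound with \<open>K = UNIV\<close> works for every direction, so it confines the exponents of the
  squared polynomials to half the Newton polygon of \<open>berg\<close>. Its sides give the three directions
  \<open>(-2, 1)\<close>, \<open>(1, -2)\<close> and \<open>(1, 1)\<close>, which leave the monomials \<open>1\<close>, \<open>x y\<close>, \<open>x y\<^sup>2\<close> and \<open>x\<^sup>2 y\<close>. Hence
  \<open>x\<^sup>2y\<^sup>2\<close> arises only from squares of \<open>x y\<close> and cannot have the coefficient \<open>-1\<close>.
\<close>
lemma berg_not_weighted_squares:
  fixes B :: "'j \<Rightarrow> ('n::finite) rpoly"
  assumes ij: "i \<noteq> j" and J: "finite J" and c: "\<And>k. k \<in> J \<Longrightarrow> 0 < c k"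
    and eq: "\<And>x. peval (berg i j) x = (\<Sum>k\<in>J. (peval (B k) x)\<^sup>2 * c k)"
  shows False
proof -
  let ?e = "pair_vec i j"
  have deg: "2 * wdeg z \<alpha> \<le> D"
    if k: "k \<in> J" and \<alpha>: "\<alpha> \<in> keys (B k)" and D: "\<And>\<beta>. \<beta> \<in> keys (berg i j) \<Longrightarrow> wdeg z \<beta> \<le> D" for k \<alpha> z D
  proof -
    have "\<exists>\<gamma>\<in>keys (single 0 (c k)). 2 * wdeg z \<alpha> + wdeg z \<gamma> \<le> D"
    proof (rule wdeg_bound_of_dominated[where K = UNIV, OF _ _ _ D \<alpha>])
      have "single 0 (c k) \<noteq> (0 :: 'n rpoly)"
        using c[OF k] by (metis less_irrefl lookup_single_eq lookup_zero)
      then show "single 0 (c k) \<noteq> (0 :: 'n rpoly)" .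
      fix x
      have "(peval (B k) x)\<^sup>2 * c k \<le> peval (berg i j) x"
        unfolding eq using k J c by (intro member_le_sum) (auto simp: less_imp_le)
      then show "\<bar>(peval (B k) x)\<^sup>2 * peval (single 0 (c k)) x\<bar> \<le> \<bar>peval (berg i j) x\<bar>"
        using c[OF k] by simp
    qed auto
    then show ?thesis by (auto split: if_splits)
  qed
  have keysB: "keys (B k) \<subseteq> {?e 0 0, ?e 1 1, ?e 1 2, ?e 2 1}" if k: "k \<in> J" for k
  proof
    fix \<alpha> assume \<alpha>: "\<alpha> \<in> keys (B k)"
    have "\<alpha> $ l = 0" if "l \<noteq> i" "l \<noteq> j" for l
    proof -
      have "2 * wdeg (axis l 1) \<alpha> \<le> 0"
        using k \<alpha> keys_berg[of i j] that by (intro deg) (auto simp: wdeg_axis pair_vec_def)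
      then show ?thesis by (simp add: wdeg_axis)
    qed
    then have \<alpha>_eq: "\<alpha> = ?e (\<alpha> $ i) (\<alpha> $ j)"
      by (auto simp: vec_eq_iff pair_vec_def)
    have "2 * wdeg (?e s t) \<alpha> \<le> D"
      if "4 * s + 2 * t \<le> D" "2 * s + 4 * t \<le> D" "2 * s + 2 * t \<le> D" "0 \<le> D" for s t D :: int
    proof (rule deg[OF k \<alpha>])
      fix \<beta> assume "\<beta> \<in> keys (berg i j)"
      then have "\<beta> \<in> {?e 4 2, ?e 2 4, ?e 2 2, ?e 0 0}" using keys_berg by blast
      then show "wdeg (?e s t) \<beta> \<le> D"
        using that ij by (auto simp: wdeg_pair_vec pair_vec_nth)
    qed
    from this[of "-2" 1 0] this[of 1 "-2" 0] this[of 1 1 6]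
    have "\<alpha> $ j \<le> 2 * (\<alpha> $ i)" "\<alpha> $ i \<le> 2 * (\<alpha> $ j)" "\<alpha> $ i + \<alpha> $ j \<le> 3"
      using ij by (auto simp: wdeg_pair_vec)
    then have "(\<alpha> $ i = 0 \<and> \<alpha> $ j = 0) \<or> (\<alpha> $ i = 1 \<and> \<alpha> $ j = 1) \<or>
        (\<alpha> $ i = 1 \<and> \<alpha> $ j = 2) \<or> (\<alpha> $ i = 2 \<and> \<alpha> $ j = 1)"
      by presburger
    then show "\<alpha> \<in> {?e 0 0, ?e 1 1, ?e 1 2, ?e 2 1}"
      by (subst \<alpha>_eq) (auto simp: pair_vec_inject[OF ij])
  qed
  define b where "b k u v = lookup (B k) (?e u v)" for k u v
  have pevalB: "peval (B k) (?e s t) = b k 0 0 + b k 1 1 * (s * t) + b k 1 2 * (s * t\<^sup>2) + b k 2 1 * (s\<^sup>2 * t)"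
    if "k \<in> J" for k s t
  proof -
    have "?e s t $ i = s" "?e s t $ j = t" using ij by (auto simp: pair_vec_def)
    then show ?thesis
      using peval_alt[OF _ keysB[OF that], of "?e s t"]
      by (simp add: pair_vec_inject[OF ij] mon_pair_vec[OF ij] b_def)
  qed
  define X Y Z where "X = (\<Sum>k\<in>J. (b k 0 0)\<^sup>2 * c k)" and "Y = (\<Sum>k\<in>J. (b k 1 1)\<^sup>2 * c k)"
    and "Z = (\<Sum>k\<in>J. ((b k 1 2)\<^sup>2 + (b k 2 1)\<^sup>2) * c k)"
  \<comment> \<open>Averaging over the four sign changes of the coordinates of \<open>(t, t)\<close> kills all mixed products,
    because the four monomials differ in the parities of their exponents.\<close>
  have main: "2 * t ^ 6 - t ^ 4 + 1 = X + Y * t ^ 4 + Z * t ^ 6" for t :: real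
  proof -
    let ?p = "\<lambda>s t. peval (berg i j) (?e s t)" and ?q = "\<lambda>k s t. peval (B k) (?e s t)"
    have berg: "?p s t = s ^ 4 * t\<^sup>2 + s\<^sup>2 * t ^ 4 - s\<^sup>2 * t\<^sup>2 + 1" for s t
      unfolding peval_berg[OF ij] using ij by (simp add: pair_vec_def)
    have "4 * (2 * t ^ 6 - t ^ 4 + 1) = ?p t t + ?p t (- t) + ?p (- t) t + ?p (- t) (- t)"
      unfolding berg by (simp add: power_even_eq flip: power_add)
    also have "\<dots> = (\<Sum>k\<in>J. ((?q k t t)\<^sup>2 + (?q k t (- t))\<^sup>2 + (?q k (- t) t)\<^sup>2 + (?q k (- t) (- t))\<^sup>2) * c k)"
      unfolding eq by (simp add: sum.distrib distrib_right)
    also have "\<dots> = (\<Sum>k\<in>J. 4 * ((b k 0 0)\<^sup>2 * c k + (b k 1 1)\<^sup>2 * c k * t ^ 4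
        + ((b k 1 2)\<^sup>2 + (b k 2 1)\<^sup>2) * c k * t ^ 6))"
    proof (rule sum.cong[OF refl])
      fix k assume k: "k \<in> J"
      have "(?q k t t)\<^sup>2 + (?q k t (- t))\<^sup>2 + (?q k (- t) t)\<^sup>2 + (?q k (- t) (- t))\<^sup>2
          = 4 * ((b k 0 0)\<^sup>2 + (b k 1 1)\<^sup>2 * t ^ 4 + ((b k 1 2)\<^sup>2 + (b k 2 1)\<^sup>2) * t ^ 6)"
        unfolding pevalB[OF k] by algebra
      then show "((?q k t t)\<^sup>2 + (?q k t (- t))\<^sup>2 + (?q k (- t) t)\<^sup>2 + (?q k (- t) (- t))\<^sup>2) * c k
          = 4 * ((b k 0 0)\<^sup>2 * c k + (b k 1 1)\<^sup>2 * c k * t ^ 4 + ((b k 1 2)\<^sup>2 + (b k 2 1)\<^sup>2) * c k * t ^ 6)"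
        by (simp add: algebra_simps)
    qed
    also have "\<dots> = 4 * (X + Y * t ^ 4 + Z * t ^ 6)"
      unfolding X_def Y_def Z_def by (simp add: sum.distrib sum_distrib_left sum_distrib_right algebra_simps)
    finally show ?thesis by simp
  qed
  have "0 \<le> Y" unfolding Y_def using c by (intro sum_nonneg) (auto simp: less_imp_le)
  \<comment> \<open>three values determine the coefficients of the polynomial in \<open>t\<close>\<close>
  moreover from main[of 0] main[of 1] main[of 2] have "Y = - 1" by simp
  ultimately show False by simp
qed

section \<open>Failure of the Strong Moment Property\<close>

context positive_tentacles
begin

text \<open>
  Let \<open>p k\<close> be \<open>berg\<close> shrunk by the factor \<open>\<epsilon> k\<close> around a point \<open>x0\<close> at which the nonzero generators
  are positive. All the \<open>p k\<close> have degree at most \<open>6\<close>, so their certificates would have a common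
  degree bound. Substituting \<open>x0 + \<epsilon> k x\<close> turns them into certificates for \<open>berg\<close> itself with the
  same bound, whose generators converge to their values at \<open>x0\<close>.
\<close>
lemma exists_nonneg_not_in_QM:
  assumes ij: "i \<noteq> (j :: 'n)"
  shows "\<exists>p. (\<forall>x. 0 \<le> peval p x) \<and> p \<notin> QM fs"
proof (rule ccontr)
  assume "\<not> ?thesis"
  then have all: "p \<in> QM fs" if "\<And>x. 0 \<le> peval p x" for p using that by blast
  obtain x0 e \<delta> where e: "e > 0" "\<delta> > 0"
    and pos: "\<forall>i<Suc (length fs). gen i \<noteq> 0 \<longrightarrow> (\<forall>x\<in>ball x0 e. \<delta> \<le> peval (gen i) x)"
    using generators_positive_on_ball by (elim exE conjE) (rule that)
  have \<delta>: "\<delta> \<le> peval (gen i) x" if "i < Suc (length fs)" "gen i \<noteq> 0" "x \<in> ball x0 e" for i x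
    using pos[rule_format, OF that] .
  define I where "I = {i. i < Suc (length fs) \<and> gen i \<noteq> 0}"
  have I: "finite I" by (simp add: I_def)
  have gen_pos: "0 < peval (gen l) x0" if "l \<in> I" for l
    using \<delta>[of l x0] that e by (fastforce simp: I_def)
  define \<epsilon> where "\<epsilon> k = e / real (Suc k)" for k
  have \<epsilon>: "0 < \<epsilon> k" "\<epsilon> k \<le> e" for k using e(1) by (auto simp: \<epsilon>_def field_simps)
  have \<epsilon>_lim: "\<epsilon> \<longlonglongrightarrow> 0"
    unfolding \<epsilon>_def[abs_def] by (rule LIMSEQ_Suc[OF lim_const_over_n])
  have "\<exists>p. \<forall>k. p k \<in> supported (degree_le 6) \<and>
      (\<forall>x. peval (p k) x = peval (berg i j) ((- inverse (\<epsilon> k)) *\<^sub>R x0 + inverse (\<epsilon> k) *\<^sub>R x))"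
    by (intro choice allI affine_substitution berg_degree ij)
  then obtain p where p: "\<And>k. p k \<in> supported (degree_le 6)"
    and peval_p: "\<And>k x. peval (p k) x = peval (berg i j) ((- inverse (\<epsilon> k)) *\<^sub>R x0 + inverse (\<epsilon> k) *\<^sub>R x)"
    by blast
  have p_sub: "peval (p k) (x0 + \<epsilon> k *\<^sub>R x) = peval (berg i j) x" for k x
  proof -
    have "(- inverse (\<epsilon> k)) *\<^sub>R x0 + inverse (\<epsilon> k) *\<^sub>R (x0 + \<epsilon> k *\<^sub>R x) = x"
      using \<epsilon>(1)[of k] by (simp add: algebra_simps)
    then show ?thesis unfolding peval_p by simp
  qed
  have pQM: "p k \<in> QM fs" for k
    by (rule all) (simp add: peval_p berg_nonneg[OF ij])
  obtain A where A: "finite A" "QM fs \<inter> supported (degree_le 6) \<subseteq> restricted_QM (supported A) fs"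
    using certificates_of_bounded_degree[OF finite_degree_le] by blast
  with p pQM have "p k \<in> restricted_QM (supported A) fs" for k by blast
  then have "\<exists>b. \<forall>k. (\<forall>i<Suc (length fs). \<forall>\<alpha>\<in>A. b k i \<alpha> \<in> supported A) \<and>
      p k = (\<Sum>i<Suc (length fs). (\<Sum>\<alpha>\<in>A. (b k i \<alpha>)\<^sup>2) * gen i)"
    unfolding restricted_QM_supported[OF A(1)] by (intro choice allI)
  then obtain b where b: "\<And>k i \<alpha>. i < Suc (length fs) \<Longrightarrow> \<alpha> \<in> A \<Longrightarrow> b k i \<alpha> \<in> supported A"
    and pb: "\<And>k. p k = (\<Sum>i<Suc (length fs). (\<Sum>\<alpha>\<in>A. (b k i \<alpha>)\<^sup>2) * gen i)"
    by blast
  obtain d where d: "A \<subseteq> degree_le d"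
    using finite_nat_set_iff_bounded_le[of "total_degree ` A"] A(1) by (auto simp: degree_le_def)
  have "\<exists>a. a \<in> supported (degree_le d) \<and> (\<forall>x. peval a x = peval (b k i \<alpha>) (x0 + \<epsilon> k *\<^sub>R x))"
    if "i \<in> I" "\<alpha> \<in> A" for k i \<alpha>
    using that b d by (intro affine_substitution supported_mono[OF d]) (auto simp: I_def)
  then have "\<exists>a. q \<in> I \<times> A \<longrightarrow> a \<in> supported (degree_le d) \<and>
      (\<forall>x. peval a x = peval (b k (fst q) (snd q)) (x0 + \<epsilon> k *\<^sub>R x))" for k q
    by auto
  then have "\<exists>a. \<forall>k q. q \<in> I \<times> A \<longrightarrow> a k q \<in> supported (degree_le d) \<and>
      (\<forall>x. peval (a k q) x = peval (b k (fst q) (snd q)) (x0 + \<epsilon> k *\<^sub>R x))"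
    by (intro choice allI)
  then obtain a where a: "\<And>k q. q \<in> I \<times> A \<Longrightarrow> a k q \<in> supported (degree_le d)"
    and peval_a: "\<And>k q x. q \<in> I \<times> A \<Longrightarrow> peval (a k q) x = peval (b k (fst q) (snd q)) (x0 + \<epsilon> k *\<^sub>R x)"
    by blast
  obtain C where C: "\<And>x. x \<in> ball 0 1 \<Longrightarrow> peval (berg i j) x \<le> C"
  proof -
    have "bounded (peval (berg i j) ` cball 0 1)"
      by (intro compact_imp_bounded compact_continuous_image continuous_on_peval compact_cball)
    then obtain C where "\<forall>x\<in>cball 0 1. \<bar>peval (berg i j) x\<bar> \<le> C" unfolding bounded_iff by auto
    then have "peval (berg i j) x \<le> C" if "x \<in> ball 0 1" for x
      using that ball_subset_cball[of "0 :: real ^ 'n" 1] by (meson abs_le_D1 subsetD)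
    with that show thesis by blast
  qed
  have "\<exists>B. (\<forall>q\<in>I \<times> A. B q \<in> supported (degree_le d)) \<and>
      (\<forall>x. peval (berg i j) x = (\<Sum>q\<in>I \<times> A. (peval (B q) x)\<^sup>2 * peval (gen (fst q)) x0))"
  proof (rule weighted_squares_limit[where U = "ball 0 1" and \<delta> = \<delta> and C = C and b = a
        and g = "\<lambda>k. peval (berg i j)" and h = "\<lambda>k q x. peval (gen (fst q)) (x0 + \<epsilon> k *\<^sub>R x)"])
    show "finite (degree_le d :: (nat ^ 'n) set)" by (rule finite_degree_le)
    show "finite (I \<times> A)" using I A by simp
    show "peval (berg i j) x = (\<Sum>q\<in>I \<times> A. (peval (a k q) x)\<^sup>2 * peval (gen (fst q)) (x0 + \<epsilon> k *\<^sub>R x))" for k x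
    proof -
      let ?y = "x0 + \<epsilon> k *\<^sub>R x"
      have "peval (berg i j) x = peval (p k) ?y" by (simp add: p_sub)
      also have "\<dots> = (\<Sum>i<Suc (length fs). \<Sum>\<alpha>\<in>A. (peval (b k i \<alpha>) ?y)\<^sup>2 * peval (gen i) ?y)"
        unfolding pb peval_sum peval_mult peval_power2 sum_distrib_right ..
      also have "\<dots> = (\<Sum>i\<in>I. \<Sum>\<alpha>\<in>A. (peval (b k i \<alpha>) ?y)\<^sup>2 * peval (gen i) ?y)"
        by (rule sum.mono_neutral_right) (auto simp: I_def)
      also have "\<dots> = (\<Sum>q\<in>I \<times> A. (peval (a k q) x)\<^sup>2 * peval (gen (fst q)) ?y)"
        unfolding sum.cartesian_product by (rule sum.cong) (auto simp: peval_a)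
      finally show ?thesis .
    qed
    show "\<delta> \<le> peval (gen (fst q)) (x0 + \<epsilon> k *\<^sub>R x)" if "q \<in> I \<times> A" "x \<in> ball 0 1" for k q x
    proof (rule \<delta>)
      show "fst q < Suc (length fs)" "gen (fst q) \<noteq> 0" using that(1) by (auto simp: I_def)
      have "norm x < 1" using that(2) by simp
      then have "\<epsilon> k * norm x < \<epsilon> k" using \<epsilon>(1)[of k] by simp
      then have "\<epsilon> k * norm x < e" using \<epsilon>(2)[of k] by (rule less_le_trans)
      then have "norm (\<epsilon> k *\<^sub>R x) < e" using \<epsilon>(1)[of k] by simp
      then show "x0 + \<epsilon> k *\<^sub>R x \<in> ball x0 e" by (simp add: dist_norm)
    qed
    show "(\<lambda>k. peval (gen (fst q)) (x0 + \<epsilon> k *\<^sub>R x)) \<longlonglongrightarrow> peval (gen (fst q)) x0" for q x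
    proof -
      have "(\<lambda>k. x0 + \<epsilon> k *\<^sub>R x) \<longlonglongrightarrow> x0 + 0 *\<^sub>R x"
        by (intro tendsto_intros \<epsilon>_lim)
      moreover have "isCont (peval (gen (fst q))) x0"
        using continuous_on_peval[of UNIV "gen (fst q)"] by (simp add: continuous_on_eq_continuous_at)
      ultimately show ?thesis using isCont_tendsto_compose by fastforce
    qed
  qed (use a C e in auto)
  then obtain B where B: "\<forall>x. peval (berg i j) x = (\<Sum>q\<in>I \<times> A. (peval (B q) x)\<^sup>2 * peval (gen (fst q)) x0)"
    by (elim exE conjE) (rule that)
  show False
  proof (rule berg_not_weighted_squares[OF ij _ _ B[rule_format]])
    show "finite (I \<times> A)" using I A by simp
    show "0 < peval (gen (fst q)) x0" if "q \<in> I \<times> A" for q using that gen_pos by auto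
  qed
qed

lemma separated_by_seminorm:
  assumes "f \<notin> QM fs"
  shows "\<exists>q. seminorm q \<and> (\<forall>g\<in>QM fs. 1 \<le> q (g - f))"
  by (rule seminorm_separation[OF QM_coefficientwise_limit assms])

lemma closed: "closed_QM (QM fs)"
  unfolding closed_QM_def by (intro closedin_finest_lc_topology separated_by_seminorm)

text \<open>
  An integral of an everywhere nonnegative polynomial is nonnegative, but closedness separates the
  polynomial from the quadratic module by a functional.
\<close>
lemma not_strong_moment_property:
  assumes quad: "quadratic_module (QM fs)" and card: "2 \<le> CARD('n)"
  shows "\<not> strong_moment_property (QM fs)"
proof
  assume smp: "strong_moment_property (QM fs)"
  obtain i j :: 'n where "i \<noteq> j"
    using card card_le_Suc0_iff_eq[of "UNIV :: 'n set"] by auto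
  then obtain p where p: "\<And>x. 0 \<le> peval p x" "p \<notin> QM fs"
    using exists_nonneg_not_in_QM by blast
  obtain q where q: "seminorm q" "\<And>g. g \<in> QM fs \<Longrightarrow> 1 \<le> q (g - p)"
    using separated_by_seminorm[OF p(2)] by blast
  have "\<exists>L :: 'n rpoly \<Rightarrow> real. linear L \<and> (\<forall>g\<in>QM fs. 0 \<le> L g) \<and> L p < 0"
  proof (rule separating_functional[OF q])
    have "0\<^sup>2 * 1 \<in> QM fs" using quad unfolding quadratic_module_def by blast
    then show "0 \<in> QM fs" by simp
    show "g + h \<in> QM fs" if "g \<in> QM fs" "h \<in> QM fs" for g h
      using quad that unfolding quadratic_module_def by blast
    show "c *\<^sub>R g \<in> QM fs" if "0 < c" "g \<in> QM fs" for c g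
    proof -
      have "c *\<^sub>R g = (single 0 (sqrt c))\<^sup>2 * g"
        using that(1)
        by (intro poly_mapping_eqI) (simp add: power2_eq_square mult_single lookup_const_mult)
      then show ?thesis using quad that(2) unfolding quadratic_module_def by auto
    qed
  qed
  then obtain L :: "'n rpoly \<Rightarrow> real" where L: "linear L" "\<forall>g\<in>QM fs. 0 \<le> L g" "L p < 0" by blast
  with smp obtain \<mu> where "L p = integral\<^sup>L \<mu> (peval p)"
    unfolding strong_moment_property_def by blast
  with p(1) have "0 \<le> L p" by simp
  with L(3) show False by simp
qed

end

section \<open>Polynomials bounded on tentacles\<close>

text \<open>
  A bound \<open>C\<close> means that \<open>p\<^sup>2\<close> is dominated by the constant polynomial \<open>C\<^sup>2\<close>, so all degrees of
  \<open>p\<close> in the directions \<open>z j\<close> are at most \<open>0\<close>.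
\<close>
lemma bounded_on_tentacles_imp_constant:
  fixes z :: "nat \<Rightarrow> int ^ 'n::finite" and p :: "'n rpoly"
  assumes r: "strictly_positive (\<Sum>j = 1..m. int (r j) *s z j)"
    and int: "\<And>j. j \<in> {1..m} \<Longrightarrow> interior (K j) \<noteq> {}"
    and bounded: "bounded (peval p ` (\<Union>j\<in>{1..m}. tentacle (K j) (z j)))"
  shows "\<exists>c. peval p = (\<lambda>x. c)"
proof -
  obtain C where C: "\<And>j x. j \<in> {1..m} \<Longrightarrow> x \<in> tentacle (K j) (z j) \<Longrightarrow> \<bar>peval p x\<bar> \<le> C"
    using bounded unfolding bounded_iff by fastforce
  have wdeg: "wdeg (z j) \<alpha> \<le> 0" if j: "j \<in> {1..m}" and \<alpha>: "\<alpha> \<in> keys p" for j \<alpha>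
  proof -
    have "\<exists>\<gamma>\<in>keys (1 :: 'n rpoly). 2 * wdeg (z j) \<alpha> + wdeg (z j) \<gamma> \<le> 0"
    proof (rule wdeg_bound_of_dominated[OF int[OF j] _ _ _ \<alpha>, where f = "single 0 (C\<^sup>2)"])
      show "\<bar>(peval p x)\<^sup>2 * peval 1 x\<bar> \<le> \<bar>peval (single 0 (C\<^sup>2)) x\<bar>"
        if "x \<in> tentacle (K j) (z j)" for x
        using C[OF j that] by (simp add: abs_le_square_iff[symmetric])
    qed (auto split: if_splits)
    then show ?thesis by simp
  qed
  have "\<alpha> = 0" if \<alpha>: "\<alpha> \<in> keys p" for \<alpha>
  proof -
    have "int (\<alpha> $ i) \<le> 0" for i
    proof -
      have "int (\<alpha> $ i) \<le> (\<Sum>j = 1..m. int (r j) * wdeg (z j) \<alpha>)"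
        using exponent_le_wdeg[OF r] by (simp add: wdeg_combination)
      also have "\<dots> \<le> 0" using wdeg \<alpha> by (intro sum_nonpos mult_nonneg_nonpos) auto
      finally show ?thesis .
    qed
    then show ?thesis by (simp add: vec_eq_iff)
  qed
  then have "keys p \<subseteq> {0}" by blast
  then have "peval p = (\<lambda>x. lookup p 0)"
    by (simp add: fun_eq_iff peval_alt[of "{0}"])
  then show ?thesis by blast
qed

lemma bounded_mon_on_tentacle:
  assumes K: "compact K" and \<alpha>: "wdeg z \<alpha> \<le> 0"
  shows "bounded (mon \<alpha> ` tentacle K z)"
proof -
  have "bounded (mon \<alpha> ` K)"
    using K by (intro compact_imp_bounded compact_continuous_image continuous_on_mon)
  then obtain C where C: "\<And>x. x \<in> K \<Longrightarrow> \<bar>mon \<alpha> x\<bar> \<le> C" unfolding bounded_iff by auto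
  have "\<bar>mon \<alpha> (stretch l z x)\<bar> \<le> C" if l: "1 \<le> l" and x: "x \<in> K" for l x
  proof -
    have "l powi wdeg z \<alpha> \<le> 1"
      using power_int_increasing[of "wdeg z \<alpha>" 0 l] \<alpha> l by simp
    moreover have "0 \<le> l powi wdeg z \<alpha>" using l by simp
    ultimately have "\<bar>l powi wdeg z \<alpha>\<bar> * \<bar>mon \<alpha> x\<bar> \<le> 1 * C"
      using C[OF x] by (intro mult_mono) auto
    then show ?thesis using l by (simp add: mon_stretch abs_mult)
  qed
  then show ?thesis unfolding bounded_iff tentacle_stretch by auto
qed

lemma mon_not_constant:
  assumes "\<alpha> \<noteq> 0"
  shows "mon \<alpha> \<noteq> (\<lambda>x. c)"
proof
  assume eq: "mon \<alpha> = (\<lambda>x. c)"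
  obtain i where "\<alpha> $ i \<noteq> 0" using assms by (auto simp: vec_eq_iff)
  then have "mon \<alpha> 0 = 0" by (auto simp: mon_def)
  moreover have "mon \<alpha> (\<chi> i. 1) = 1" by (simp add: mon_def)
  ultimately show False unfolding eq by simp
qed

theorem theorem5p4:
  fixes S :: "(real ^ 'n::finite) set"
    and m :: nat
    and K :: "nat \<Rightarrow> (real ^ 'n) set"
    and z :: "nat \<Rightarrow> int ^ 'n"
  assumes "basic_closed_semialgebraic S"
    and "\<And>j. j \<in> {1..m} \<Longrightarrow> compact (K j)"
    and "\<And>j. j \<in> {1..m} \<Longrightarrow> interior (K j) \<noteq> {}"
    and "\<And>j. j \<in> {1..m} \<Longrightarrow> tentacle (K j) (z j) \<subseteq> S"
  shows "((\<exists>r :: nat \<Rightarrow> nat. strictly_positive (\<Sum>j = 1..m. int (r j) *s z j)) \<longrightarrow>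
           (\<forall>M. fin_gen_quadratic_module M \<and> nonneg_set M = S \<longrightarrow> stable_QM M \<and> closed_QM M) \<and>
           (2 \<le> CARD('n) \<longrightarrow>
             (\<forall>M. fin_gen_quadratic_module M \<and> nonneg_set M = S \<longrightarrow> \<not> strong_moment_property M)))
       \<and> ((\<exists>r :: nat \<Rightarrow> nat. strictly_positive (\<Sum>j = 1..m. int (r j) *s z j)) \<longleftrightarrow>
           (\<forall>p :: 'n rpoly. bounded (peval p ` (\<Union>j\<in>{1..m}. tentacle (K j) (z j))) \<longleftrightarrow>
              (\<exists>c. peval p = (\<lambda>x. c))))"
proof -
  let ?positive = "\<lambda>r. strictly_positive (\<Sum>j = 1..m. int (r j) *s z j)"
  let ?T = "\<Union>j\<in>{1..m}. tentacle (K j) (z j)"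
  have part1: "stable_QM M \<and> closed_QM M \<and> (2 \<le> CARD('n) \<longrightarrow> \<not> strong_moment_property M)"
    if r: "?positive r" and M: "fin_gen_quadratic_module M" "nonneg_set M = S" for r :: "nat \<Rightarrow> nat" and M
  proof -
    from M(1) obtain fs where quad: "quadratic_module (QM fs)" and fs: "M = QM fs"
      unfolding fin_gen_quadratic_module_def by blast
    have nonneg: "0 \<le> peval f x" if "j \<in> {1..m}" "f \<in> set fs" "x \<in> tentacle (K j) (z j)" for j f x
    proof -
      have "f \<in> M" unfolding fs using that(2) by (intro mem_QM) simp
      moreover have "x \<in> nonneg_set M" using assms(4) M(2) that by blast
      ultimately show ?thesis by (simp add: nonneg_set_def)
    qed
    interpret positive_tentacles fs m K z r
      using assms(3) nonneg r by unfold_locales blast+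
    show ?thesis
      unfolding fs using stable closed not_strong_moment_property[OF quad] by blast
  qed
  have bounded_const: "bounded (peval p ` ?T)" if "peval p = (\<lambda>x. c)" for p :: "'n rpoly" and c
    unfolding that by (rule bounded_subset[of "{c}"]) auto
  have "(\<exists>r :: nat \<Rightarrow> nat. ?positive r) \<longleftrightarrow>
      (\<forall>p :: 'n rpoly. bounded (peval p ` ?T) \<longleftrightarrow> (\<exists>c. peval p = (\<lambda>x. c)))"
  proof
    assume "\<exists>r :: nat \<Rightarrow> nat. ?positive r"
    then obtain r :: "nat \<Rightarrow> nat" where "?positive r" by blast
    then show "\<forall>p :: 'n rpoly. bounded (peval p ` ?T) \<longleftrightarrow> (\<exists>c. peval p = (\<lambda>x. c))"
      using bounded_on_tentacles_imp_constant[where K = K] assms(3) bounded_const by blast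
  next
    assume only: "\<forall>p :: 'n rpoly. bounded (peval p ` ?T) \<longleftrightarrow> (\<exists>c. peval p = (\<lambda>x. c))"
    show "\<exists>r :: nat \<Rightarrow> nat. ?positive r"
    proof (rule ccontr)
      assume "\<not> ?thesis"
      then obtain \<alpha> where \<alpha>: "\<alpha> \<noteq> 0" "\<forall>j\<in>{1..m}. wdeg (z j) \<alpha> \<le> 0"
        using strictly_positive_combination_or_exponent[where z = z] by blast
      have peval: "peval (single \<alpha> 1) = mon \<alpha>" by (simp add: fun_eq_iff)
      have "bounded (\<Union>j\<in>{1..m}. mon \<alpha> ` tentacle (K j) (z j))"
      proof (intro bounded_UN ballI)
        show "bounded (mon \<alpha> ` tentacle (K j) (z j))" if "j \<in> {1..m}" for j
          using bounded_mon_on_tentacle[OF assms(2)[OF that]] \<alpha>(2) that by blast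
      qed simp
      then have "bounded (peval (single \<alpha> 1) ` ?T)"
        by (simp only: peval image_UN)
      with only obtain c where "mon \<alpha> = (\<lambda>x. c)" unfolding peval[symmetric] by blast
      with mon_not_constant[OF \<alpha>(1)] show False by blast
    qed
  qed
  with part1 show ?thesis by blast
qed

end
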